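(* Let $\mathcal A$ be a set of actions, $\mathcal L$ a set of functions $\mathcal A\to\mathbb R$, and $d_{\mathcal A,\infty}(a,b)=\sup_{\ell\in\mathcal L}|\ell(a)-\ell(b)|$. Let $c>0$ satisfy $c\ge\sup_{a,b\in\mathcal A}d_{\mathcal A,\infty}(a,b)$, let $L\ge1$ be an integer, let $\mathcal A_0=\{a_0\}$ for an arbitrary $a_0\in\mathcal A$, and for $j=1,\dots,L$ let $\mathcal A_j\subseteq\mathcal A$ be a finite $c2^{-j}$-cover of $\mathcal A$ with respect to $d_{\mathcal A,\infty}$. Let $\mathcal T$ be the pruned tree built from $(\mathcal A_j)_{j=0}^L$ as described in the context. Suppose the learner runs the two-point FTRL algorithm (described in the context) on $\mathcal T$ with $\sigma_j=c\,2^{3-j}$ and $\delta_j\propto2^{-2j/3}|\mathcal A_j|^{1/3}$ (normalized so that $\sum_{j=1}^L\delta_j=1$). Then, if $\min_{1\le j\le L}\delta_j\ge1/T$, $$\mathrm{Reg}^{(2)}_T\le16\,(9+4\sqrt6)\sqrt{K_{\mathrm{eff}}\,T}+c\,2^{-L}\,T,\qquad K_{\mathrm{eff}}=c^2\Big(\sum_{j=1}^L2^{-2j/3}|\mathcal A_j|^{1/3}\Big)^3 .$$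
   Context: Cover: $\mathcal A'\subseteq\mathcal A$ is an $\epsilon$-cover if $\min_{a'\in\mathcal A'}d_{\mathcal A,\infty}(a,a')\le\epsilon$ for all $a\in\mathcal A$. Tree $\mathcal T$: nodes at level $j$ are elements of $\mathcal A_j$ (an action occurring in several covers gives distinct nodes). For $j\ge1$, the parent of $a\in\mathcal A_j$ is an element of $\arg\min_{a'\in\mathcal A_{j-1}}d_{\mathcal A,\infty}(a,a')$, ties broken arbitrarily. Nodes with no descendant in $\mathcal A_L$ are deleted; the level-$j$ node set of the resulting tree is denoted $V_j\subseteq\mathcal A_j$, so that $V_L=\mathcal A_L$, $V_0=\{a_0\}$, and all leaves are at level $L$. Notation: $\mathrm{anc}_j(v)$ is the level-$j$ ancestor of $v$ (a node is its own ancestor); $a\sim_jb$ iff $\mathrm{anc}_j(a)=\mathrm{anc}_j(b)$. $\Delta$ denotes the probability simplex over $\mathcal A_L$, and for $x\in\mathbb R^{\mathcal A_L}$ and a node $v$, $x[v]$ is the sum of $x(a)$ over leaves $a\in\mathcal A_L$ descending from $v$. Two-point FTRL algorithm on $\mathcal T$: $p_1=\arg\min_{p\in\Delta}\psi_1(p)$; at each round $t\ge1$: sample $A_{t,1}\sim p_t$, independently $j_t\sim\delta$, and $A_{t,2}$ from $p_t$ conditioned on $A_{t,2}\sim_{j_t-1}A_{t,1}$; play both; for all $a\in\mathcal A_L$ set $z_t(a)=\mathbf 1\{a\sim_{j_t}A_{t,1}\}\frac{y_t(A_{t,1})-y_t(A_{t,2})+\sigma_{j_t}}{\delta_{j_t}p_t[\mathrm{anc}_{j_t}(A_{t,1})]}$;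 set $p_{t+1}=\arg\min_{p\in\Delta}\langle\sum_{s\le t}z_s,p\rangle+\psi_{t+1}(p)$. Here $\psi_t(p)=2\sqrt6\sum_{j=1}^L\frac{\sigma_j}{\sqrt{\delta_j}}\sqrt{\max\{t,6/\delta_j\}}\sum_{v\in V_j}(p[v]-\sqrt{p[v]})$. Game: at each round $t$ the environment secretly draws $y_t\in\mathcal L$; the learner plays two actions $A_{t,1},A_{t,2}\in\mathcal A$, observes $y_t(A_{t,1}),y_t(A_{t,2})$ and incurs their average. $y_t$ may depend on everything up to round $t-1$ but is independent of the learner's actions at round $t$ or later, conditionally on the events up to the end of round $t-1$. Losses are integrable so that expectations are defined. The regret is with respect to the whole set $\mathcal A$: $\mathrm{Reg}^{(2)}_T=\mathbb E\big[\sum_{t=1}^T\frac12(y_t(A_{t,1})+y_t(A_{t,2}))\big]-\inf_{a\in\mathcal A}\mathbb E\big[\sum_{t=1}^Ty_t(a)\big]$. *)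

theory Defs
  imports "HOL-Probability.Probability"
begin

text \<open>
  Actions live in a type \<open>'a\<close> with carrier \<open>A :: 'a set\<close>; losses are functions
  \<open>'a \<Rightarrow> real\<close> of which only the values on \<open>A\<close> are ever used.
  The distance is \<open>ennreal\<close>-valued, so that an infinite supremum is not lost.
\<close>

definition loss_dist :: "('a \<Rightarrow> real) set \<Rightarrow> 'a \<Rightarrow> 'a \<Rightarrow> ennreal" where
  "loss_dist Loss a b = (SUP l\<in>Loss. ennreal \<bar>l a - l b\<bar>)"

definition is_cover :: "('a \<Rightarrow> real) set \<Rightarrow> 'a set \<Rightarrow> real \<Rightarrow> 'a set \<Rightarrow> bool" where
  "is_cover Loss A \<epsilon> C \<longleftrightarrow> C \<subseteq> A \<and> (\<forall>a\<in>A. \<exists>a'\<in>C. loss_dist Loss a a' \<le> ennreal \<epsilon>)"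


section \<open>The tree\<close>

text \<open>
  A node is a pair of a level \<open>j\<close> and an element of \<open>cov j\<close>; the level is always carried
  as a separate argument, so equal actions at different levels are different nodes.
  \<open>par j a\<close> is the level-\<open>(j - 1)\<close> parent of the level-\<open>j\<close> node \<open>a\<close>.
  Since \<open>par\<close> is an arbitrary function satisfying the following predicate,
  ties are broken arbitrarily.
\<close>

definition nearest_parents ::
  "('a \<Rightarrow> real) set \<Rightarrow> (nat \<Rightarrow> 'a set) \<Rightarrow> nat \<Rightarrow> (nat \<Rightarrow> 'a \<Rightarrow> 'a) \<Rightarrow> bool" where
  "nearest_parents Loss cov L par \<longleftrightarrow>
     (\<forall>j\<in>{1..L}. \<forall>a\<in>cov j. is_arg_min (loss_dist Loss a) (\<lambda>a'. a' \<in> cov (j - 1)) (par j a))"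

text \<open>\<open>anc par j i v\<close> is the level-\<open>j\<close> ancestor of the level-\<open>i\<close> node \<open>v\<close>, for \<open>j \<le> i\<close>.\<close>

primrec anc :: "(nat \<Rightarrow> 'a \<Rightarrow> 'a) \<Rightarrow> nat \<Rightarrow> nat \<Rightarrow> 'a \<Rightarrow> 'a" where
  "anc par j 0 v = v"
| "anc par j (Suc i) v = (if Suc i \<le> j then v else anc par j i (par (Suc i) v))"

text \<open>Level-\<open>j\<close> nodes that survive the deletion of nodes without descendants at level \<open>L\<close>.\<close>

definition nodes :: "(nat \<Rightarrow> 'a set) \<Rightarrow> (nat \<Rightarrow> 'a \<Rightarrow> 'a) \<Rightarrow> nat \<Rightarrow> nat \<Rightarrow> 'a set" where
  "nodes cov par L j = {v \<in> cov j. \<exists>a\<in>cov L. anc par j L a = v}"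

definition same_anc :: "(nat \<Rightarrow> 'a \<Rightarrow> 'a) \<Rightarrow> nat \<Rightarrow> nat \<Rightarrow> 'a \<Rightarrow> 'a \<Rightarrow> bool" where
  "same_anc par L j a b \<longleftrightarrow> anc par j L a = anc par j L b"

text \<open>\<open>mass cov par L x j v\<close> is \<open>x[v]\<close> for a level-\<open>j\<close> node \<open>v\<close>.\<close>

definition mass ::
  "(nat \<Rightarrow> 'a set) \<Rightarrow> (nat \<Rightarrow> 'a \<Rightarrow> 'a) \<Rightarrow> nat \<Rightarrow> ('a \<Rightarrow> real) \<Rightarrow> nat \<Rightarrow> 'a \<Rightarrow> real" where
  "mass cov par L x j v = (\<Sum>a | a \<in> cov L \<and> anc par j L a = v. x a)"


section \<open>The two-point FTRL algorithm\<close>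

text \<open>Probability vectors on \<open>S\<close>, extended by zero so that each has a unique representative.\<close>

definition prob_simplex :: "'a set \<Rightarrow> ('a \<Rightarrow> real) set" where
  "prob_simplex S = {p. (\<forall>a\<in>S. 0 \<le> p a) \<and> (\<forall>a. a \<notin> S \<longrightarrow> p a = 0) \<and> (\<Sum>a\<in>S. p a) = 1}"

definition regularizer ::
  "(nat \<Rightarrow> 'a set) \<Rightarrow> (nat \<Rightarrow> 'a \<Rightarrow> 'a) \<Rightarrow> nat \<Rightarrow> (nat \<Rightarrow> real) \<Rightarrow> (nat \<Rightarrow> real)
    \<Rightarrow> nat \<Rightarrow> ('a \<Rightarrow> real) \<Rightarrow> real" where
  "regularizer cov par L \<sigma> \<delta> t p =
     2 * sqrt 6 * (\<Sum>j=1..L. \<sigma> j / sqrt (\<delta> j) * sqrt (max (real t) (6 / \<delta> j)) *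
       (\<Sum>v\<in>nodes cov par L j. mass cov par L p j v - sqrt (mass cov par L p j v)))"

text \<open>
  Probability of drawing \<open>(A\<^sub>1, j, A\<^sub>2) = (a, j, b)\<close>: draw \<open>a\<close> from \<open>p\<close>, independently \<open>j\<close> from
  \<open>\<delta>\<close>, and then \<open>b\<close> from \<open>p\<close> conditioned on \<open>b\<close> sharing the level-\<open>(j - 1)\<close> ancestor of \<open>a\<close>.
\<close>

definition draw_prob ::
  "(nat \<Rightarrow> 'a set) \<Rightarrow> (nat \<Rightarrow> 'a \<Rightarrow> 'a) \<Rightarrow> nat \<Rightarrow> (nat \<Rightarrow> real) \<Rightarrow> ('a \<Rightarrow> real)
    \<Rightarrow> 'a \<Rightarrow> nat \<Rightarrow> 'a \<Rightarrow> real" where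
  "draw_prob cov par L \<delta> p a j b =
     p a * \<delta> j *
     (if same_anc par L (j - 1) b a
      then p b / mass cov par L p (j - 1) (anc par (j - 1) L a) else 0)"

text \<open>
  The estimate \<open>z(a)\<close> formed from the draw \<open>(a1, j)\<close> and the two observed losses
  \<open>r1\<close> (of the first action) and \<open>r2\<close> (of the second action).
\<close>

definition loss_estimate ::
  "(nat \<Rightarrow> 'a set) \<Rightarrow> (nat \<Rightarrow> 'a \<Rightarrow> 'a) \<Rightarrow> nat \<Rightarrow> (nat \<Rightarrow> real) \<Rightarrow> (nat \<Rightarrow> real)
    \<Rightarrow> ('a \<Rightarrow> real) \<Rightarrow> 'a \<Rightarrow> nat \<Rightarrow> real \<Rightarrow> real \<Rightarrow> 'a \<Rightarrow> real" where
  "loss_estimate cov par L \<sigma> \<delta> p a1 j r1 r2 a =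
     (if same_anc par L j a a1
      then (r1 - r2 + \<sigma> j) / (\<delta> j * mass cov par L p j (anc par j L a1)) else 0)"


section \<open>The game\<close>

definition cond_indep :: "'w measure \<Rightarrow> 'w measure \<Rightarrow> 'w measure \<Rightarrow> 'w measure \<Rightarrow> bool" where
  "cond_indep M F G H \<longleftrightarrow>
     (\<forall>B\<in>sets G. \<forall>C\<in>sets H. AE \<omega> in M.
        real_cond_exp M F (indicator (B \<inter> C)) \<omega> =
        real_cond_exp M F (indicator B) \<omega> * real_cond_exp M F (indicator C) \<omega>)"

text \<open>
  \<open>F t\<close> consists of the events up to the end of round \<open>t\<close>; rounds are numbered from 1, and \<open>F\<close> may
  be larger than the filtration generated by the play, so the environment may use private
  randomness. The loss \<open>y t\<close> need not be measurable with respect to \<open>F (t - 1)\<close>.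
  The learner's move in round \<open>t\<close> is its two actions together with its internal draw \<open>lev t\<close>.
  Later moves do depend on \<open>y t\<close> through the feedback, but \<open>y t\<close> belongs to
  the past \<open>F t\<close> on which they are conditioned.
\<close>

locale two_point_game = prob_space M + filtration "space M" F
  for M :: "'w measure" and F :: "nat \<Rightarrow> 'w measure" +
  fixes A :: "'a set"
    and Loss :: "('a \<Rightarrow> real) set"
    and y :: "nat \<Rightarrow> 'w \<Rightarrow> 'a \<Rightarrow> real"
    and act1 :: "nat \<Rightarrow> 'w \<Rightarrow> 'a"
    and lev :: "nat \<Rightarrow> 'w \<Rightarrow> nat"
    and act2 :: "nat \<Rightarrow> 'w \<Rightarrow> 'a"
  assumes F_subalgebra: "\<And>t. subalgebra M (F t)"
    and loss_in: "\<And>t \<omega>. 1 \<le> t \<Longrightarrow> \<omega> \<in> space M \<Longrightarrow> y t \<omega> \<in> Loss"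
    and loss_measurable: "\<And>t a. 1 \<le> t \<Longrightarrow> a \<in> A \<Longrightarrow> (\<lambda>\<omega>. y t \<omega> a) \<in> borel_measurable (F t)"
    and loss_integrable: "\<And>t a. 1 \<le> t \<Longrightarrow> a \<in> A \<Longrightarrow> integrable M (\<lambda>\<omega>. y t \<omega> a)"
    and act1_measurable: "\<And>t. 1 \<le> t \<Longrightarrow> act1 t \<in> F t \<rightarrow>\<^sub>M count_space A"
    and lev_measurable: "\<And>t. 1 \<le> t \<Longrightarrow> lev t \<in> F t \<rightarrow>\<^sub>M count_space UNIV"
    and act2_measurable: "\<And>t. 1 \<le> t \<Longrightarrow> act2 t \<in> F t \<rightarrow>\<^sub>M count_space A"
    and loss_indep_move: "\<And>t. 1 \<le> t \<Longrightarrow>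
      cond_indep M (F (t - 1))
        (vimage_algebra (space M) (\<lambda>\<omega>. restrict (y t \<omega>) A) (\<Pi>\<^sub>M a\<in>A. borel))
        (vimage_algebra (space M) (\<lambda>\<omega>. (act1 t \<omega>, lev t \<omega>, act2 t \<omega>))
           (count_space A \<Otimes>\<^sub>M (count_space UNIV \<Otimes>\<^sub>M count_space A)))"

definition two_point_ftrl ::
  "'w measure \<Rightarrow> (nat \<Rightarrow> 'w measure) \<Rightarrow> (nat \<Rightarrow> 'a set) \<Rightarrow> (nat \<Rightarrow> 'a \<Rightarrow> 'a) \<Rightarrow> nat
    \<Rightarrow> (nat \<Rightarrow> real) \<Rightarrow> (nat \<Rightarrow> real)
    \<Rightarrow> (nat \<Rightarrow> 'w \<Rightarrow> 'a \<Rightarrow> real) \<Rightarrow> (nat \<Rightarrow> 'w \<Rightarrow> 'a) \<Rightarrow> (nat \<Rightarrow> 'w \<Rightarrow> nat) \<Rightarrow> (nat \<Rightarrow> 'w \<Rightarrow> 'a)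
    \<Rightarrow> (nat \<Rightarrow> 'w \<Rightarrow> 'a \<Rightarrow> real) \<Rightarrow> bool" where
  "two_point_ftrl M F cov par L \<sigma> \<delta> y act1 lev act2 p \<longleftrightarrow>
     (\<forall>t\<ge>1. \<forall>\<omega>\<in>space M. act1 t \<omega> \<in> cov L \<and> lev t \<omega> \<in> {1..L} \<and> act2 t \<omega> \<in> cov L) \<and>
     (\<forall>\<omega>\<in>space M.
        is_arg_min (regularizer cov par L \<sigma> \<delta> 1) (\<lambda>q. q \<in> prob_simplex (cov L)) (p 1 \<omega>)) \<and>
     (\<forall>t\<ge>1. \<forall>\<omega>\<in>space M.
        is_arg_min
          (\<lambda>q. (\<Sum>a\<in>cov L.
                  (\<Sum>s=1..t. loss_estimate cov par L \<sigma> \<delta> (p s \<omega>) (act1 s \<omega>) (lev s \<omega>)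
                     (y s \<omega> (act1 s \<omega>)) (y s \<omega> (act2 s \<omega>)) a) * q a)
               + regularizer cov par L \<sigma> \<delta> (t + 1) q)
          (\<lambda>q. q \<in> prob_simplex (cov L)) (p (t + 1) \<omega>)) \<and>
     (\<forall>t\<ge>1. \<forall>a\<in>cov L. \<forall>j\<in>{1..L}. \<forall>b\<in>cov L. AE \<omega> in M.
        real_cond_exp M (F (t - 1))
          (indicator {\<omega> \<in> space M. act1 t \<omega> = a \<and> lev t \<omega> = j \<and> act2 t \<omega> = b}) \<omega> =
        draw_prob cov par L \<delta> (p t \<omega>) a j b)"

text \<open>
  The infimum is over reals: it is meaningful when \<open>A\<close> is nonempty and the expected cumulative
  losses are bounded below, e.g. when \<open>loss_dist\<close> is bounded on \<open>A\<close>.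
\<close>

definition regret2 ::
  "'w measure \<Rightarrow> 'a set \<Rightarrow> (nat \<Rightarrow> 'w \<Rightarrow> 'a \<Rightarrow> real) \<Rightarrow> (nat \<Rightarrow> 'w \<Rightarrow> 'a) \<Rightarrow> (nat \<Rightarrow> 'w \<Rightarrow> 'a)
    \<Rightarrow> nat \<Rightarrow> real" where
  "regret2 M A y act1 act2 T =
     (\<integral>\<omega>. (\<Sum>t=1..T. (y t \<omega> (act1 t \<omega>) + y t \<omega> (act2 t \<omega>)) / 2) \<partial>M)
     - (INF a\<in>A. \<integral>\<omega>. (\<Sum>t=1..T. y t \<omega> a) \<partial>M)"


section \<open>Parameters\<close>

definition level_weight :: "(nat \<Rightarrow> 'a set) \<Rightarrow> nat \<Rightarrow> real" where
  "level_weight cov j = 2 powr (- 2 * real j / 3) * real (card (cov j)) powr (1 / 3)"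

definition level_dist :: "(nat \<Rightarrow> 'a set) \<Rightarrow> nat \<Rightarrow> nat \<Rightarrow> real" where
  "level_dist cov L j = level_weight cov j / (\<Sum>i=1..L. level_weight cov i)"

definition level_scale :: "real \<Rightarrow> nat \<Rightarrow> real" where
  "level_scale c j = c * 2 powr (3 - real j)"

definition K_eff :: "real \<Rightarrow> (nat \<Rightarrow> 'a set) \<Rightarrow> nat \<Rightarrow> real" where
  "K_eff c cov L =
     c\<^sup>2 * (\<Sum>j=1..L. 2 powr (- 2 * real j / 3) * real (card (cov j)) powr (1 / 3)) ^ 3"

end

theory Submission
  imports Defs
begin

text \<open>
  Given the past, the estimate \<open>z\<^sub>t(a)\<close> has mean
  \<open>\<Sum>\<^sub>j (y[anc\<^sub>j a] - y[anc\<^sub>j\<^sub>-\<^sub>1 a] + \<sigma>\<^sub>j)\<close>, where \<open>y[v]\<close> is the mean of \<open>y\<^sub>t\<close> under \<open>p\<^sub>t\<close>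
  conditioned on the leaves below \<open>v\<close>. This telescopes to \<open>y\<^sub>t(a)\<close> plus a constant, so the expected
  regret against a leaf is the expected regret on the estimates.

  For a fixed round \<open>z\<^sub>t\<close> charges a single node \<open>v\<close> with a weight \<open>0 \<le> w \<le> 2\<sigma>\<^sub>j / (\<delta>\<^sub>j p\<^sub>t[v])\<close>, nonnegative
  because actions with a common level-\<open>(j - 1)\<close> ancestor have losses within \<open>\<sigma>\<^sub>j\<close>. The part \<open>-\<eta> \<surd>p[v]\<close> of
  the regularizer alone then bounds the stability term by
  \<open>2 w\<^sup>2 p\<^sub>t[v] powr (3/2) / \<eta>\<close>, whose mean involves only \<open>\<Sum>\<^sub>v \<surd>p\<^sub>t[v] \<le> \<surd>|A\<^sub>j|\<close>, and the
  same sum bounds the penalty term. For the given parameters both are multiples of \<open>\<surd>(K\<^sub>e\<^sub>f\<^sub>f T)\<close>.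
\<close>

section \<open>Masses on the tree\<close>

text \<open>The offset \<open>\<sigma> j\<close> in the estimates is free: its contribution to their
  mean is the same at every leaf, and two probability vectors have equal totals. It buys the sign of
  w. For nonnegative w the change of the objective can be written with squares whatever the size of
  w, so the stability bound holds however small \<open>p\<^sub>t[v]\<close> is.

  Two obstacles shape the measure theory. The iterate \<open>p t\<close> is only known to be a
  minimizer, with no measurability, so expectations are computed for a copy rebuilt from the
  conditional probabilities of the moves. And \<open>1 / p\<^sub>t[v]\<close> has no bound fixed in
  advance; integrability always comes from pairing it with the conditional probability of the move
  that produces it, which is at most \<open>\<delta> j * p\<^sub>t[v]\<close>.

  Passing from the leaves to all actions costs the radius of the last cover in every round, which is
  the term linear in T.\<close>

locale level_tree =
  fixes cov :: "nat \<Rightarrow> 'a set" and par :: "nat \<Rightarrow> 'a \<Rightarrow> 'a" and L :: nat and a0 :: 'a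
  assumes finite_cov: "\<And>j. j \<le> L \<Longrightarrow> finite (cov j)"
    and leaves_nonempty: "cov L \<noteq> {}"
    and root: "cov 0 = {a0}"
    and par_in_cov: "\<And>j a. j \<in> {1..L} \<Longrightarrow> a \<in> cov j \<Longrightarrow> par j a \<in> cov (j - 1)"
begin

abbreviation anc_leaf :: "nat \<Rightarrow> 'a \<Rightarrow> 'a" where "anc_leaf j \<equiv> anc par j L"
abbreviation tmass :: "('a \<Rightarrow> real) \<Rightarrow> nat \<Rightarrow> 'a \<Rightarrow> real" where "tmass \<equiv> mass cov par L"
abbreviation tnodes :: "nat \<Rightarrow> 'a set" where "tnodes \<equiv> nodes cov par L"

lemma anc_self [simp]: "anc par i i v = v"
  by (cases i) auto

lemma anc_in_cov: "j \<le> i \<Longrightarrow> i \<le> L \<Longrightarrow> v \<in> cov i \<Longrightarrow> anc par j i v \<in> cov j"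
proof (induction i arbitrary: v)
  case (Suc i)
  show ?case
  proof (cases "Suc i \<le> j")
    case True
    then have "j = Suc i" using Suc.prems by simp
    then show ?thesis using Suc.prems by simp
  next
    case False
    have "par (Suc i) v \<in> cov i" using par_in_cov[of "Suc i" v] Suc.prems by simp
    then show ?thesis using False Suc by simp
  qed
qed simp

text \<open>The definition of \<open>anc\<close> recurses at the leaf end. This is the unfolding at
  the root end, for arguments that move the target level while the leaf stays fixed.\<close>

lemma anc_step: "j < i \<Longrightarrow> anc par j i v = par (Suc j) (anc par (Suc j) i v)"
proof (induction i arbitrary: v)
  case (Suc i)
  then show ?case by (cases "j = i") auto
qed simp

lemma same_anc_coarsen:
  assumes "i \<le> j" "j \<le> L" "anc_leaf j a = anc_leaf j b"
  shows "anc_leaf i a = anc_leaf i b"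
  using assms(1)
proof (induction rule: inc_induct)
  case (step n)
  then show ?case using anc_step[of n L] assms(2) by simp
qed (fact assms(3))

lemma anc_root: "a \<in> cov L \<Longrightarrow> anc_leaf 0 a = a0"
  using anc_in_cov[of 0 L a] root by simp

lemma finite_leaves [simp]: "finite (cov L)"
  using finite_cov by simp

lemma nodes_eq: "j \<le> L \<Longrightarrow> tnodes j = anc_leaf j ` cov L"
  unfolding nodes_def using anc_in_cov[of j L] by auto

lemma finite_nodes: "j \<le> L \<Longrightarrow> finite (tnodes j)"
  by (simp add: nodes_eq)

lemma nodes_subset: "tnodes j \<subseteq> cov j"
  unfolding nodes_def by auto

lemma mass_affine:
  "tmass (\<lambda>a. (1 - l) * p a + l * q a) j v = (1 - l) * tmass p j v + l * tmass q j v"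
  unfolding mass_def by (simp add: sum.distrib sum_distrib_left)

lemma mass_diff: "tmass (\<lambda>a. p a - q a) j v = tmass p j v - tmass q j v"
  unfolding mass_def by (simp add: sum_subtractf)

lemma mass_point: "b \<in> cov L \<Longrightarrow> tmass (\<lambda>a. of_bool (a = b)) j v = of_bool (anc_leaf j b = v)"
  unfolding mass_def of_bool_def by (auto simp: sum.inter_filter[symmetric])

lemma sum_mass:
  assumes "j \<le> L"
  shows "(\<Sum>v\<in>tnodes j. f v * tmass p j v) = (\<Sum>a\<in>cov L. f (anc_leaf j a) * p a)"
proof -
  have "(\<Sum>a\<in>cov L. f (anc_leaf j a) * p a) =
     (\<Sum>v\<in>tnodes j. \<Sum>a\<in>{a \<in> cov L. anc_leaf j a = v}. f (anc_leaf j a) * p a)"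
    unfolding nodes_eq[OF assms] by (rule sum.image_gen) simp
  also have "\<dots> = (\<Sum>v\<in>tnodes j. f v * tmass p j v)"
    unfolding mass_def by (auto simp: sum_distrib_left intro!: sum.cong)
  finally show ?thesis by simp
qed

lemma mass_nonneg: "p \<in> prob_simplex (cov L) \<Longrightarrow> 0 \<le> tmass p j v"
  unfolding mass_def prob_simplex_def by (auto intro!: sum_nonneg)

lemma sum_mass_eq_1: "p \<in> prob_simplex (cov L) \<Longrightarrow> j \<le> L \<Longrightarrow> (\<Sum>v\<in>tnodes j. tmass p j v) = 1"
  using sum_mass[of j "\<lambda>_. 1" p] by (simp add: prob_simplex_def)

lemma mass_le_1: "p \<in> prob_simplex (cov L) \<Longrightarrow> tmass p j v \<le> 1"
proof -
  assume p: "p \<in> prob_simplex (cov L)"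
  have "tmass p j v \<le> (\<Sum>a\<in>cov L. p a)"
    unfolding mass_def using p by (intro sum_mono2) (auto simp: prob_simplex_def)
  then show ?thesis using p by (simp add: prob_simplex_def)
qed

lemma le_mass: "p \<in> prob_simplex (cov L) \<Longrightarrow> a \<in> cov L \<Longrightarrow> p a \<le> tmass p j (anc_leaf j a)"
  unfolding mass_def by (rule member_le_sum) (auto simp: prob_simplex_def)

lemma mass_leaf: "a \<in> cov L \<Longrightarrow> tmass p L a = p a"
proof -
  assume "a \<in> cov L"
  then have "{b. b \<in> cov L \<and> anc_leaf L b = a} = {a}" by auto
  then show ?thesis unfolding mass_def by simp
qed

lemma mass_root: "p \<in> prob_simplex (cov L) \<Longrightarrow> tmass p 0 a0 = 1"
proof -
  assume p: "p \<in> prob_simplex (cov L)"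
  have "{b. b \<in> cov L \<and> anc_leaf 0 b = a0} = cov L" using anc_root by auto
  then show ?thesis unfolding mass_def using p by (simp add: prob_simplex_def)
qed

text \<open>Cauchy-Schwarz with total mass 1. Pruning only removes nodes, so the size of the cover
  bounds their number.\<close>

lemma sum_sqrt_mass_le:
  assumes "p \<in> prob_simplex (cov L)" "j \<le> L"
  shows "(\<Sum>v\<in>tnodes j. sqrt (tmass p j v)) \<le> sqrt (card (cov j))"
proof -
  have "(\<Sum>v\<in>tnodes j. sqrt (tmass p j v))\<^sup>2
      \<le> (\<Sum>v\<in>tnodes j. (sqrt (tmass p j v))\<^sup>2) * card (tnodes j)"
    by (rule sum_squared_le_sum_of_squares)
  also have "\<dots> = card (tnodes j)"
    using sum_mass_eq_1[OF assms] mass_nonneg[OF assms(1)] by simp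
  also have "\<dots> \<le> card (cov j)"
    using card_mono[OF finite_cov[OF assms(2)] nodes_subset] by simp
  finally show ?thesis by (rule real_le_rsqrt)
qed

lemma one_le_sum_sqrt_mass:
  assumes "p \<in> prob_simplex (cov L)" "j \<le> L"
  shows "1 \<le> (\<Sum>v\<in>tnodes j. sqrt (tmass p j v))"
proof -
  have "x \<le> sqrt x" if "0 \<le> x" "x \<le> 1" for x :: real
    using that by (metis real_le_rsqrt power2_eq_square mult_left_le)
  then have "(\<Sum>v\<in>tnodes j. tmass p j v) \<le> (\<Sum>v\<in>tnodes j. sqrt (tmass p j v))"
    using mass_nonneg[OF assms(1)] mass_le_1[OF assms(1)] by (intro sum_mono) auto
  then show ?thesis using sum_mass_eq_1[OF assms] by simp
qed

text \<open>This is \<open>y[v]\<close> of the overview for v = \<open>anc_leaf j a\<close>. The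
  index is a leaf below the node, so that the means can themselves be averaged over leaves with
  weights \<open>p\<close>.\<close>

definition cond_avg :: "('a \<Rightarrow> real) \<Rightarrow> ('a \<Rightarrow> real) \<Rightarrow> nat \<Rightarrow> 'a \<Rightarrow> real" where
  "cond_avg p x j a =
     (\<Sum>b | b \<in> cov L \<and> anc_leaf j b = anc_leaf j a. p b * x b) / tmass p j (anc_leaf j a)"

lemma cond_avg_cong: "anc_leaf j a = anc_leaf j b \<Longrightarrow> cond_avg p x j a = cond_avg p x j b"
  unfolding cond_avg_def by simp

lemma cond_avg_leaf: "a \<in> cov L \<Longrightarrow> p a \<noteq> 0 \<Longrightarrow> cond_avg p x L a = x a"
proof -
  assume a: "a \<in> cov L" "p a \<noteq> 0"
  then have "{b. b \<in> cov L \<and> b = a} = {a}" by auto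
  then show ?thesis unfolding cond_avg_def using a by (simp add: mass_leaf)
qed

lemma cond_avg_root:
  "p \<in> prob_simplex (cov L) \<Longrightarrow> a \<in> cov L \<Longrightarrow> cond_avg p x 0 a = (\<Sum>b\<in>cov L. p b * x b)"
proof -
  assume a: "p \<in> prob_simplex (cov L)" "a \<in> cov L"
  then have "{b. b \<in> cov L \<and> anc_leaf 0 b = anc_leaf 0 a} = cov L" using anc_root by auto
  then show ?thesis unfolding cond_avg_def using a by (simp add: mass_root anc_root)
qed

text \<open>Tower property. The two leaves of the double sum may be exchanged because sharing an
  ancestor is symmetric and the mass depends on the ancestor only.\<close>

lemma sum_cond_avg:
  assumes "\<And>a. a \<in> cov L \<Longrightarrow> tmass p j (anc_leaf j a) \<noteq> 0"
  shows "(\<Sum>a\<in>cov L. p a * cond_avg p x j a) = (\<Sum>a\<in>cov L. p a * x a)"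
proof -
  let ?m = "\<lambda>a. tmass p j (anc_leaf j a)"
  have "(\<Sum>a\<in>cov L. p a * cond_avg p x j a) =
     (\<Sum>a\<in>cov L. \<Sum>b\<in>cov L. if anc_leaf j b = anc_leaf j a then p a * (p b * x b) / ?m a else 0)"
    unfolding cond_avg_def
    by (simp add: sum_distrib_left sum_divide_distrib flip: sum.inter_filter)
  also have "\<dots> = (\<Sum>b\<in>cov L. \<Sum>a\<in>cov L. if anc_leaf j b = anc_leaf j a then p a * (p b * x b) / ?m a else 0)"
    by (rule sum.swap)
  also have "\<dots> = (\<Sum>b\<in>cov L. \<Sum>a\<in>cov L. if anc_leaf j a = anc_leaf j b then p a * (p b * x b) / ?m b else 0)"
    by (intro sum.cong refl) auto
  also have "\<dots> = (\<Sum>b\<in>cov L. ?m b * (p b * x b) / ?m b)"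
    unfolding mass_def
    by (simp add: sum_distrib_right sum_divide_distrib flip: sum.inter_filter)
  also have "\<dots> = (\<Sum>b\<in>cov L. p b * x b)"
    using assms by (intro sum.cong) auto
  finally show ?thesis .
qed

end

section \<open>Unbiasedness of the estimates\<close>

locale weighted_tree = level_tree +
  fixes \<sigma> \<delta> :: "nat \<Rightarrow> real"
  assumes \<sigma>_pos: "\<And>j. j \<in> {1..L} \<Longrightarrow> 0 < \<sigma> j"
    and \<delta>_pos: "\<And>j. j \<in> {1..L} \<Longrightarrow> 0 < \<delta> j"
    and sum_\<delta>: "(\<Sum>j=1..L. \<delta> j) = 1"
begin

abbreviation tdraw :: "('a \<Rightarrow> real) \<Rightarrow> 'a \<Rightarrow> nat \<Rightarrow> 'a \<Rightarrow> real" where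
  "tdraw \<equiv> draw_prob cov par L \<delta>"
abbreviation testimate :: "('a \<Rightarrow> real) \<Rightarrow> 'a \<Rightarrow> nat \<Rightarrow> real \<Rightarrow> real \<Rightarrow> 'a \<Rightarrow> real" where
  "testimate \<equiv> loss_estimate cov par L \<sigma> \<delta>"

lemma sum_draw_prob_snd:
  "(\<Sum>b\<in>cov L. tdraw p a j b * x b) = p a * \<delta> j * cond_avg p x (j - 1) a"
  unfolding draw_prob_def same_anc_def cond_avg_def
  by (simp add: sum_distrib_left sum_divide_distrib sum.inter_filter if_distrib cong: if_cong)
     (auto intro!: sum.cong)

context
  fixes p :: "'a \<Rightarrow> real"
  assumes p: "p \<in> prob_simplex (cov L)" and p_pos: "\<And>a. a \<in> cov L \<Longrightarrow> 0 < p a"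
begin

lemma mass_pos: "a \<in> cov L \<Longrightarrow> 0 < tmass p j (anc_leaf j a)"
  using le_mass[OF p, of a j] p_pos[of a] by linarith

lemma cond_avg_const: "a \<in> cov L \<Longrightarrow> cond_avg p (\<lambda>_. u) j a = u"
proof -
  assume a: "a \<in> cov L"
  have "(\<Sum>b | b \<in> cov L \<and> anc_leaf j b = anc_leaf j a. p b * u) = tmass p j (anc_leaf j a) * u"
    by (simp add: mass_def sum_distrib_right)
  then show ?thesis unfolding cond_avg_def using mass_pos[OF a, of j] by simp
qed

lemma sum_draw_prob_const: "a \<in> cov L \<Longrightarrow> (\<Sum>b\<in>cov L. tdraw p a j b) = p a * \<delta> j"
  using sum_draw_prob_snd[of p a j "\<lambda>_. 1"] cond_avg_const[of a 1] by simp

lemma draw_prob_fst: "a \<in> cov L \<Longrightarrow> (\<Sum>j=1..L. \<Sum>b\<in>cov L. tdraw p a j b) = p a"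
  using sum_\<delta> by (simp add: sum_draw_prob_const flip: sum_distrib_left)

lemma expected_fst:
  "(\<Sum>a\<in>cov L. \<Sum>j=1..L. \<Sum>b\<in>cov L. tdraw p a j b * x a) = (\<Sum>a\<in>cov L. p a * x a)"
  by (simp add: draw_prob_fst del: One_nat_def flip: sum_distrib_right)

text \<open>Redrawing a leaf from its own conditional law below an ancestor leaves \<open>p\<close>
  invariant, whichever level is drawn. Both actions therefore have the same mean loss, and the
  comparison action adds nothing to the regret.\<close>

lemma expected_snd:
  "(\<Sum>a\<in>cov L. \<Sum>j=1..L. \<Sum>b\<in>cov L. tdraw p a j b * x b) = (\<Sum>a\<in>cov L. p a * x a)"
proof -
  have m: "\<And>a j. a \<in> cov L \<Longrightarrow> tmass p j (anc_leaf j a) \<noteq> 0"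
    using mass_pos by (metis less_irrefl)
  have "(\<Sum>a\<in>cov L. \<Sum>j=1..L. \<Sum>b\<in>cov L. tdraw p a j b * x b)
      = (\<Sum>j=1..L. \<Sum>a\<in>cov L. p a * \<delta> j * cond_avg p x (j - 1) a)"
    by (subst sum.swap) (simp add: sum_draw_prob_snd)
  also have "\<dots> = (\<Sum>j=1..L. \<delta> j * (\<Sum>a\<in>cov L. p a * cond_avg p x (j - 1) a))"
    by (simp add: sum_distrib_left mult_ac)
  also have "\<dots> = (\<Sum>a\<in>cov L. p a * x a)"
    using sum_\<delta> by (simp add: sum_cond_avg[OF m] flip: sum_distrib_right)
  finally show ?thesis .
qed

text \<open>The inverse weights cancel the probability of the level and of the level-j node of
  \<open>a'\<close>. What remains is the first loss conditioned on that node and the second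
  conditioned on its parent. The telescope ends at the root with the mean over all leaves, and at
  level \<open>L\<close> with \<open>x a'\<close> alone.\<close>

lemma expected_estimate:
  assumes a': "a' \<in> cov L"
  shows "(\<Sum>a\<in>cov L. \<Sum>j=1..L. \<Sum>b\<in>cov L. tdraw p a j b * testimate p a j (x a) (x b) a')
    = x a' - (\<Sum>a\<in>cov L. p a * x a) + (\<Sum>j=1..L. \<sigma> j)"
proof -
  let ?m = "\<lambda>j. tmass p j (anc_leaf j a')"
  let ?X = "cond_avg p x"
  have level: "(\<Sum>a\<in>cov L. \<Sum>b\<in>cov L. tdraw p a j b * testimate p a j (x a) (x b) a')
     = ?X j a' - ?X (j - 1) a' + \<sigma> j" if j: "j \<in> {1..L}" for j
  proof -
    have "(\<Sum>b\<in>cov L. tdraw p a j b * testimate p a j (x a) (x b) a') =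
      (if anc_leaf j a = anc_leaf j a'
       then (p a * x a - p a * (?X (j - 1) a' - \<sigma> j)) / ?m j else 0)"
      if a: "a \<in> cov L" for a
    proof (cases "anc_leaf j a = anc_leaf j a'")
      case True
      \<comment> \<open>Leaves below the same level-j node also share its parent, so the mean of the
        second loss is one constant on the whole event.\<close>
      then have "anc_leaf (j - 1) a = anc_leaf (j - 1) a'"
        using same_anc_coarsen[of "j - 1" j a a'] j by simp
      then have X: "?X (j - 1) a = ?X (j - 1) a'" by (rule cond_avg_cong)
      have "(\<Sum>b\<in>cov L. tdraw p a j b * testimate p a j (x a) (x b) a')
        = ((x a + \<sigma> j) * (\<Sum>b\<in>cov L. tdraw p a j b) - (\<Sum>b\<in>cov L. tdraw p a j b * x b)) / (\<delta> j * ?m j)"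
        unfolding loss_estimate_def same_anc_def using True
        by (simp add: sum_divide_distrib sum_distrib_left sum_subtractf[symmetric])
           (auto intro!: sum.cong simp: algebra_simps)
      also have "\<dots> = ((x a + \<sigma> j) * (p a * \<delta> j) - p a * \<delta> j * ?X (j - 1) a') / (\<delta> j * ?m j)"
        using a X by (simp only: sum_draw_prob_const sum_draw_prob_snd)
      also have "\<dots> = (p a * x a - p a * (?X (j - 1) a' - \<sigma> j)) / ?m j"
        using \<delta>_pos[OF j] mass_pos[OF a', of j] by (simp add: field_simps)
      finally show ?thesis using True by simp
    next
      case False
      then show ?thesis by (auto simp: loss_estimate_def same_anc_def)
    qed
    then have "(\<Sum>a\<in>cov L. \<Sum>b\<in>cov L. tdraw p a j b * testimate p a j (x a) (x b) a')
      = (\<Sum>a | a \<in> cov L \<and> anc_leaf j a = anc_leaf j a'.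
           (p a * x a - p a * (?X (j - 1) a' - \<sigma> j)) / ?m j)"
      by (simp add: sum.inter_filter del: One_nat_def)
    also have "\<dots> = ?X j a' - cond_avg p (\<lambda>_. ?X (j - 1) a' - \<sigma> j) j a'"
      unfolding cond_avg_def by (simp add: sum_subtractf diff_divide_distrib flip: sum_divide_distrib)
    also have "\<dots> = ?X j a' - ?X (j - 1) a' + \<sigma> j"
      using cond_avg_const[OF a'] by simp
    finally show ?thesis .
  qed
  have "(\<Sum>a\<in>cov L. \<Sum>j=1..L. \<Sum>b\<in>cov L. tdraw p a j b * testimate p a j (x a) (x b) a')
     = (\<Sum>j=1..L. ?X j a' - ?X (j - 1) a' + \<sigma> j)"
    by (subst sum.swap) (simp add: level)
  also have "\<dots> = ?X L a' - ?X 0 a' + (\<Sum>j=1..L. \<sigma> j)"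
    using sum_telescope''[of 0 L "\<lambda>j. ?X j a'"] by (simp add: sum.distrib)
  finally show ?thesis
    using cond_avg_leaf[OF a', of p x] cond_avg_root[OF p a', of x] p_pos[OF a'] by simp
qed

text \<open>\<open>p\<close> and the point mass at \<open>b'\<close> have the same total, so every
  part of the mean estimate that does not depend on the leaf drops out.\<close>

lemma expected_estimated_regret:
  assumes b': "b' \<in> cov L"
  shows "(\<Sum>a\<in>cov L. \<Sum>j=1..L. \<Sum>b\<in>cov L. tdraw p a j b *
      (\<Sum>a'\<in>cov L. testimate p a j (x a) (x b) a' * (p a' - of_bool (a' = b'))))
    = (\<Sum>a\<in>cov L. p a * x a) - x b'"
proof -
  have swap: "(\<Sum>a\<in>cov L. \<Sum>j=1..L. \<Sum>b\<in>cov L. \<Sum>a'\<in>cov L. f a j b a')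
    = (\<Sum>a'\<in>cov L. \<Sum>a\<in>cov L. \<Sum>j=1..L. \<Sum>b\<in>cov L. f a j b a')"
    for f :: "'a \<Rightarrow> nat \<Rightarrow> 'a \<Rightarrow> 'a \<Rightarrow> real"
    by (simp only: sum.cartesian_product) (rule sum.reindex_bij_witness[of _
      "\<lambda>(a', a, j, b). (a, j, b, a')" "\<lambda>(a, j, b, a'). (a', a, j, b)"]; auto)
  have "(\<Sum>a\<in>cov L. \<Sum>j=1..L. \<Sum>b\<in>cov L. tdraw p a j b *
      (\<Sum>a'\<in>cov L. testimate p a j (x a) (x b) a' * (p a' - of_bool (a' = b'))))
    = (\<Sum>a'\<in>cov L. (\<Sum>a\<in>cov L. \<Sum>j=1..L. \<Sum>b\<in>cov L. tdraw p a j b * testimate p a j (x a) (x b) a')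
        * (p a' - of_bool (a' = b')))"
    unfolding sum_distrib_left sum_distrib_right by (subst swap) (simp only: mult.assoc)
  also have "\<dots> = (\<Sum>a'\<in>cov L. (x a' - (\<Sum>a\<in>cov L. p a * x a) + (\<Sum>j=1..L. \<sigma> j))
        * (p a' - of_bool (a' = b')))"
    by (simp add: expected_estimate del: One_nat_def)
  also have "\<dots> = (\<Sum>a'\<in>cov L. p a' * x a') - x b'
       + ((\<Sum>j=1..L. \<sigma> j) - (\<Sum>a\<in>cov L. p a * x a)) * ((\<Sum>a'\<in>cov L. p a') - 1)"
  proof -
    have "(\<Sum>a'\<in>cov L. (x a' - A + B) * (p a' - of_bool (a' = b')))
      = (\<Sum>a'\<in>cov L. p a' * x a') - x b' + (B - A) * ((\<Sum>a'\<in>cov L. p a') - 1)" for A B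
    proof -
      have "(\<Sum>a'\<in>cov L. (x a' - A + B) * (p a' - of_bool (a' = b')))
        = (\<Sum>a'\<in>cov L. p a' * x a' + (B - A) * p a' - (if a' = b' then x a' + (B - A) else 0))"
        by (intro sum.cong) (auto simp: algebra_simps)
      also have "\<dots> = (\<Sum>a'\<in>cov L. p a' * x a') + (B - A) * (\<Sum>a'\<in>cov L. p a') - (x b' + (B - A))"
        using b' by (simp add: sum.distrib sum_subtractf sum_distrib_left)
      finally show ?thesis by (simp add: algebra_simps)
    qed
    then show ?thesis .
  qed
  finally show ?thesis using p by (simp add: prob_simplex_def)
qed

text \<open>The inverse root of a node mass is averaged with that very mass, which leaves the root
  itself. Small nodes therefore do no harm in expectation.\<close>

lemma expected_stability:
  assumes "\<And>j. j \<in> {1..L} \<Longrightarrow> 0 \<le> C j"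
  shows "(\<Sum>a\<in>cov L. \<Sum>j=1..L. \<Sum>b\<in>cov L. tdraw p a j b * (C j / sqrt (tmass p j (anc_leaf j a))))
    \<le> (\<Sum>j=1..L. \<delta> j * C j * sqrt (card (cov j)))"
proof -
  have "(\<Sum>a\<in>cov L. \<Sum>j=1..L. \<Sum>b\<in>cov L. tdraw p a j b * (C j / sqrt (tmass p j (anc_leaf j a))))
    = (\<Sum>j=1..L. \<delta> j * C j * (\<Sum>a\<in>cov L. 1 / sqrt (tmass p j (anc_leaf j a)) * p a))"
    unfolding sum_distrib_right[symmetric]
    by (subst sum.swap) (simp add: sum_draw_prob_const sum_distrib_left mult_ac)
  also have "\<dots> = (\<Sum>j=1..L. \<delta> j * C j * (\<Sum>v\<in>tnodes j. sqrt (tmass p j v)))"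
  proof (intro sum.cong refl)
    fix j assume j: "j \<in> {1..L}"
    have "(\<Sum>a\<in>cov L. 1 / sqrt (tmass p j (anc_leaf j a)) * p a)
        = (\<Sum>v\<in>tnodes j. 1 / sqrt (tmass p j v) * tmass p j v)"
      using j by (simp only: sum_mass[where f = "\<lambda>v. 1 / sqrt (tmass p j v)"] atLeastAtMost_iff)
    also have "\<dots> = (\<Sum>v\<in>tnodes j. sqrt (tmass p j v))"
      using mass_nonneg[OF p] by (intro sum.cong refl) (simp add: real_div_sqrt)
    finally show "\<delta> j * C j * (\<Sum>a\<in>cov L. 1 / sqrt (tmass p j (anc_leaf j a)) * p a)
       = \<delta> j * C j * (\<Sum>v\<in>tnodes j. sqrt (tmass p j v))" by simp
  qed
  also have "\<dots> \<le> (\<Sum>j=1..L. \<delta> j * C j * sqrt (card (cov j)))"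
    using sum_sqrt_mass_le[OF p] assms \<delta>_pos
    by (intro sum_mono mult_left_mono) (auto simp: less_imp_le)
  finally show ?thesis .
qed

end

end

section \<open>FTRL with the tree regularizer\<close>

lemma sqrt_concave:
  fixes x y l :: real
  assumes "0 \<le> x" "0 \<le> y" "0 \<le> l" "l \<le> 1"
  shows "(1 - l) * sqrt x + l * sqrt y \<le> sqrt ((1 - l) * x + l * y)"
proof (rule real_le_rsqrt)
  have "(1 - l) * x + l * y - ((1 - l) * sqrt x + l * sqrt y)\<^sup>2
      = (1 - l) * (sqrt x)\<^sup>2 + l * (sqrt y)\<^sup>2 - ((1 - l) * sqrt x + l * sqrt y)\<^sup>2"
    using assms by simp
  also have "\<dots> = l * (1 - l) * (sqrt x - sqrt y)\<^sup>2"
    by (simp add: power2_eq_square algebra_simps)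
  also have "\<dots> \<ge> 0" using assms by simp
  finally show "((1 - l) * sqrt x + l * sqrt y)\<^sup>2 \<le> (1 - l) * x + l * y" by simp
qed

lemma prob_simplex_mix:
  assumes "p \<in> prob_simplex S" "q \<in> prob_simplex S" "0 \<le> l" "l \<le> 1"
  shows "(\<lambda>a. (1 - l) * p a + l * q a) \<in> prob_simplex S"
  using assms by (auto simp: prob_simplex_def sum.distrib simp flip: sum_distrib_left)

lemma point_in_prob_simplex: "finite S \<Longrightarrow> b \<in> S \<Longrightarrow> (\<lambda>a. of_bool (a = b)) \<in> prob_simplex S"
  by (auto simp: prob_simplex_def of_bool_def)

context weighted_tree
begin

text \<open>The coefficient \<eta> with which level j enters the regularizer in round t.\<close>

definition rate :: "nat \<Rightarrow> nat \<Rightarrow> real" where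
  "rate t j = 2 * sqrt 6 * (\<sigma> j / sqrt (\<delta> j) * sqrt (max (real t) (6 / \<delta> j)))"

abbreviation treg :: "nat \<Rightarrow> ('a \<Rightarrow> real) \<Rightarrow> real" where
  "treg \<equiv> regularizer cov par L \<sigma> \<delta>"

lemma rate_pos: "j \<in> {1..L} \<Longrightarrow> 0 < rate t j"
  unfolding rate_def using \<sigma>_pos[of j] \<delta>_pos[of j] by (simp add: less_max_iff_disj)

lemma rate_mono: "j \<in> {1..L} \<Longrightarrow> s \<le> t \<Longrightarrow> rate s j \<le> rate t j"
  unfolding rate_def using \<sigma>_pos[of j] \<delta>_pos[of j]
  by (intro mult_left_mono real_sqrt_le_mono max.mono) auto

lemma regularizer_eq_rate:
  "treg t p = (\<Sum>j=1..L. rate t j * (\<Sum>v\<in>tnodes j. tmass p j v - sqrt (tmass p j v)))"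
  unfolding regularizer_def rate_def by (simp add: sum_distrib_left mult.assoc)

text \<open>On the simplex the linear part equals 1 at each level, so it cannot influence the
  minimizer. Its effect is to make the regularizer vanish at point masses, where the comparator
  lies.\<close>

lemma regularizer_eq:
  assumes "p \<in> prob_simplex (cov L)"
  shows "treg t p = (\<Sum>j=1..L. rate t j * (1 - (\<Sum>v\<in>tnodes j. sqrt (tmass p j v))))"
  unfolding regularizer_eq_rate
  using sum_mass_eq_1[OF assms] by (intro sum.cong refl) (simp add: sum_subtractf)

lemma regularizer_point:
  assumes "b \<in> cov L"
  shows "treg t (\<lambda>a. of_bool (a = b)) = 0"
  unfolding regularizer_eq_rate mass_point[OF assms] by (auto intro!: sum.neutral)

text \<open>Strict convexity is only needed in the direction of a single node, so that
  no differentiability of the regularizer at its minimizer is required.\<close>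

lemma regularizer_convex:
  assumes p: "p \<in> prob_simplex (cov L)" and q: "q \<in> prob_simplex (cov L)"
    and l: "0 \<le> l" "l \<le> 1" and j: "j \<in> {1..L}" and v: "v \<in> tnodes j"
  shows "treg t (\<lambda>a. (1 - l) * p a + l * q a) \<le> (1 - l) * treg t p + l * treg t q
     - rate t j * (sqrt ((1 - l) * tmass p j v + l * tmass q j v)
         - (1 - l) * sqrt (tmass p j v) - l * sqrt (tmass q j v))"
proof -
  define gap where "gap i u = sqrt ((1 - l) * tmass p i u + l * tmass q i u)
         - (1 - l) * sqrt (tmass p i u) - l * sqrt (tmass q i u)" for i u
  have gap: "0 \<le> gap i u" for i u
    unfolding gap_def
    using sqrt_concave[OF mass_nonneg[OF p] mass_nonneg[OF q] l, of i u i u] by linarith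
  have "rate t j * gap j v \<le> rate t j * (\<Sum>u\<in>tnodes j. gap j u)"
    using rate_pos[OF j, of t] v gap j finite_nodes[of j]
    by (intro mult_left_mono member_le_sum) auto
  also have "\<dots> \<le> (\<Sum>i=1..L. rate t i * (\<Sum>u\<in>tnodes i. gap i u))"
    using rate_pos gap j
    by (intro member_le_sum[of j "{1..L}" "\<lambda>i. rate t i * (\<Sum>u\<in>tnodes i. gap i u)"])
       (auto intro!: mult_nonneg_nonneg sum_nonneg simp: less_imp_le)
  \<comment> \<open>Linear parts cancel along a segment, so the convexity defect is the weighted sum
    of the square-root gaps of all nodes. All are nonnegative, and one is kept.\<close>
  also have "\<dots> = (1 - l) * treg t p + l * treg t q - treg t (\<lambda>a. (1 - l) * p a + l * q a)"
    unfolding regularizer_eq_rate mass_affine gap_def sum_distrib_left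
      sum.distrib[symmetric] sum_subtractf[symmetric]
    by (intro sum.cong refl) (simp add: algebra_simps)
  finally show ?thesis unfolding gap_def by linarith
qed

section \<open>Minimizers of the FTRL objective\<close>

definition objective :: "('a \<Rightarrow> real) \<Rightarrow> nat \<Rightarrow> ('a \<Rightarrow> real) \<Rightarrow> real" where
  "objective Z t q = (\<Sum>a\<in>cov L. Z a * q a) + treg t q"

context
  fixes Z :: "'a \<Rightarrow> real" and t :: nat and p :: "'a \<Rightarrow> real"
  assumes min: "is_arg_min (objective Z t) (\<lambda>q. q \<in> prob_simplex (cov L)) p"
begin

lemma minimizer_in_simplex: "p \<in> prob_simplex (cov L)"
  using min by (simp add: is_arg_min_def)

text \<open>The point at fraction \<open>l\<close> towards \<open>q\<close> has at least the minimal
  value, yet lies below the chord by at least the gap of the chosen node. Together these bound the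
  gap by \<open>l\<close> times the excess of \<open>q\<close>.\<close>

lemma minimizer_gap:
  assumes q: "q \<in> prob_simplex (cov L)"
    and l: "0 \<le> l" "l \<le> 1" and j: "j \<in> {1..L}" and v: "v \<in> tnodes j"
  shows "rate t j * (sqrt ((1 - l) * tmass p j v + l * tmass q j v)
         - (1 - l) * sqrt (tmass p j v) - l * sqrt (tmass q j v))
     \<le> l * (objective Z t q - objective Z t p)"
proof -
  let ?r = "\<lambda>a. (1 - l) * p a + l * q a"
  have "objective Z t p \<le> objective Z t ?r"
    using min prob_simplex_mix[OF minimizer_in_simplex q l] by (force simp: is_arg_min_def)
  moreover have "(\<Sum>a\<in>cov L. Z a * ?r a)
      = (1 - l) * (\<Sum>a\<in>cov L. Z a * p a) + l * (\<Sum>a\<in>cov L. Z a * q a)"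
    unfolding sum_distrib_left sum.distrib[symmetric]
    by (intro sum.cong refl) (simp add: algebra_simps)
  ultimately show ?thesis
    using regularizer_convex[OF minimizer_in_simplex q l j v, of t]
    unfolding objective_def by (simp add: algebra_simps)
qed

text \<open>The slope of the square root at 0 is infinite.\<close>

lemma minimizer_pos:
  assumes L: "1 \<le> L" and a: "a \<in> cov L"
  shows "0 < p a"
proof (rule ccontr)
  assume "\<not> 0 < p a"
  then have pa: "p a = 0"
    using minimizer_in_simplex a by (force simp: prob_simplex_def)
  let ?q = "\<lambda>b. of_bool (b = a) :: real"
  define D where "D = objective Z t ?q - objective Z t p"
  \<comment> \<open>The step towards the vertex is \<open>s\<^sup>2\<close>, so that the square root
    gains s against costs of order \<open>s\<^sup>2\<close>. This s makes
    \<open>s * (rate t L + \<bar>D\<bar>)\<close> half the rate.\<close>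
  define s where "s = rate t L / (2 * (rate t L + \<bar>D\<bar>))"
  have r: "0 < rate t L" using rate_pos[of L t] L by simp
  have s: "0 < s" "s < 1" unfolding s_def using r by (auto simp: field_simps)
  have s2: "s\<^sup>2 \<le> 1" using s by (simp add: power_le_one)
  have q: "?q \<in> prob_simplex (cov L)" using point_in_prob_simplex[OF finite_leaves a] .
  have v: "a \<in> tnodes L" using nodes_eq[of L] a by simp
  have "rate t L * (s - s\<^sup>2) \<le> s\<^sup>2 * D"
    using minimizer_gap[OF q _ s2, of L a] L v s pa
    unfolding D_def by (simp add: mass_leaf[OF a])
  then have "s * rate t L \<le> s * (s * (rate t L + D))"
    by (simp add: power2_eq_square algebra_simps)
  then have "rate t L \<le> s * (rate t L + D)" using s by simp
  also have "\<dots> \<le> s * (rate t L + \<bar>D\<bar>)" using s by simp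
  also have "\<dots> = rate t L / 2" unfolding s_def using r by (simp add: field_simps)
  finally show False using r by simp
qed

text \<open>This is \<open>minimizer_gap\<close> divided by l, as l tends to 0 from the right. The
  limit is the Bregman divergence of the negative square root between the two masses, so optimality
  is exploited along one segment at a time.\<close>

lemma minimizer_growth:
  assumes q: "q \<in> prob_simplex (cov L)" and j: "j \<in> {1..L}" and v: "v \<in> tnodes j"
    and pos: "0 < tmass p j v"
  shows "rate t j * (sqrt (tmass q j v) - sqrt (tmass p j v))\<^sup>2 / (2 * sqrt (tmass p j v))
     \<le> objective Z t q - objective Z t p"
proof -
  define x y where "x = tmass p j v" and "y = tmass q j v"
  have x: "0 < x" and y: "0 \<le> y" unfolding x_def y_def using pos mass_nonneg[OF q] by auto
  let ?f = "\<lambda>l. sqrt (x + l * (y - x))"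
  \<comment> \<open>The form \<open>0 + l\<close> makes the quotient literally the one in
    \<open>DERIV_def\<close> at the point 0.\<close>
  let ?G = "\<lambda>l. rate t j * ((?f (0 + l) - ?f 0) / l + sqrt x - sqrt y)"
  have "(?f has_real_derivative (y - x) / (2 * sqrt x)) (at 0)"
    using x by (auto intro!: derivative_eq_intros simp: field_simps)
  then have "((\<lambda>l. (?f (0 + l) - ?f 0) / l) \<longlongrightarrow> (y - x) / (2 * sqrt x)) (at 0)"
    by (simp add: DERIV_def)
  then have "((\<lambda>l. (?f (0 + l) - ?f 0) / l) \<longlongrightarrow> (y - x) / (2 * sqrt x)) (at_right 0)"
    by (rule filterlim_mono) (auto simp: at_le)
  then have lim: "(?G \<longlongrightarrow> rate t j * ((y - x) / (2 * sqrt x) + sqrt x - sqrt y)) (at_right 0)"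
    by (intro tendsto_mult tendsto_add tendsto_diff tendsto_const)
  have "eventually (\<lambda>l::real. l \<in> {0<..<1}) (at_right 0)"
    by (rule eventually_at_right_real) simp
  then have "eventually (\<lambda>l. ?G l \<le> objective Z t q - objective Z t p) (at_right 0)"
  proof eventually_elim
    case (elim l)
    then have l: "0 < l" "l \<le> 1" by auto
    have "rate t j * (sqrt ((1 - l) * x + l * y) - (1 - l) * sqrt x - l * sqrt y)
        \<le> l * (objective Z t q - objective Z t p)"
      using minimizer_gap[OF q _ l(2) j v] l unfolding x_def y_def by simp
    moreover have "(1 - l) * x + l * y = x + l * (y - x)" by (simp add: algebra_simps)
    ultimately show ?case using l(1) by (simp add: field_simps)
  qed
  with lim have "rate t j * ((y - x) / (2 * sqrt x) + sqrt x - sqrt y)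
      \<le> objective Z t q - objective Z t p"
    by (rule tendsto_upperbound) simp
  moreover have "(y - x) / (2 * sqrt x) + sqrt x - sqrt y = (sqrt y - sqrt x)\<^sup>2 / (2 * sqrt x)"
  proof -
    have "y - x = (sqrt y)\<^sup>2 - (sqrt x)\<^sup>2" using x y by simp
    then show ?thesis using x by (simp add: field_simps power2_eq_square)
  qed
  ultimately show ?thesis unfolding x_def y_def by (simp only: times_divide_eq_right)
qed

text \<open>Shifting mass away from v gains w times the decrease, while
  \<open>minimizer_growth\<close> charges a square in the root of the mass. The subtracted term
  bounds what this trade can earn.\<close>

lemma minimizer_stable:
  assumes q: "q \<in> prob_simplex (cov L)" and j: "j \<in> {1..L}" and v: "v \<in> tnodes j"
    and pos: "0 < tmass p j v" and w: "0 \<le> w"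
  shows "objective Z t p + w * tmass p j v - 2 * w\<^sup>2 * sqrt (tmass p j v) ^ 3 / rate t j
     \<le> objective Z t q + w * tmass q j v"
proof -
  define r s where "r = sqrt (tmass p j v)" and "s = sqrt (tmass q j v)"
  define e where "e = rate t j"
  have r: "0 < r" and e: "0 < e" unfolding r_def e_def using pos rate_pos[OF j] by auto
  have m: "tmass p j v = r\<^sup>2" "tmass q j v = s\<^sup>2"
    unfolding r_def s_def using pos mass_nonneg[OF q] by auto
  \<comment> \<open>A square is completed in s, leaving \<open>w * (s - r)\<^sup>2\<close>; this
    remainder is where the sign of w matters.\<close>
  have "w * (s\<^sup>2 - r\<^sup>2) + e * (s - r)\<^sup>2 / (2 * r) + 2 * w\<^sup>2 * r ^ 3 / e
     = w * (s - r)\<^sup>2 + (e * (r - s) - 2 * w * r\<^sup>2)\<^sup>2 / (2 * r * e)"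
    using r e by (simp add: field_simps power2_eq_square power3_eq_cube)
  also have "\<dots> \<ge> 0" using w r e by simp
  finally have "0 \<le> w * (s\<^sup>2 - r\<^sup>2) + e * (s - r)\<^sup>2 / (2 * r) + 2 * w\<^sup>2 * r ^ 3 / e" .
  moreover have "e * (s - r)\<^sup>2 / (2 * r) \<le> objective Z t q - objective Z t p"
    using minimizer_growth[OF q j v pos] unfolding r_def s_def e_def .
  ultimately show ?thesis unfolding m using m r
    by (simp add: algebra_simps real_sqrt_abs e_def flip: r_def)
qed

end

section \<open>Regret on the estimates\<close>

lemma estimate_inner:
  "(\<Sum>a'\<in>cov L. testimate p a j r1 r2 a' * q a')
    = (r1 - r2 + \<sigma> j) / (\<delta> j * tmass p j (anc_leaf j a)) * tmass q j (anc_leaf j a)"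
  unfolding loss_estimate_def same_anc_def mass_def[of _ _ _ q]
  by (simp add: sum.inter_filter sum_distrib_left if_distrib cong: if_cong)
     (auto intro!: sum.cong)

text \<open>Induction in the style of be-the-leader: the bound after n rounds, proved for all
  comparators at once, is applied to the next iterate. \<open>minimizer_stable\<close> pays for
  \<open>p t\<close> being chosen before \<open>z t\<close> is seen, and the growing rates give the
  last sum.\<close>

lemma ftrl_regret:
  fixes p :: "nat \<Rightarrow> 'a \<Rightarrow> real" and a :: "nat \<Rightarrow> 'a" and j :: "nat \<Rightarrow> nat"
    and r1 r2 :: "nat \<Rightarrow> real"
  defines "z \<equiv> \<lambda>t. testimate (p t) (a t) (j t) (r1 t) (r2 t)"
  assumes L: "1 \<le> L"
    and min: "\<And>t. 1 \<le> t \<Longrightarrow> is_arg_min (objective (\<lambda>a. \<Sum>s=1..t - 1. z s a) t)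
      (\<lambda>q. q \<in> prob_simplex (cov L)) (p t)"
    and a: "\<And>t. 1 \<le> t \<Longrightarrow> a t \<in> cov L"
    and j: "\<And>t. 1 \<le> t \<Longrightarrow> j t \<in> {1..L}"
    and range: "\<And>t. 1 \<le> t \<Longrightarrow> \<bar>r1 t - r2 t\<bar> \<le> \<sigma> (j t)"
    and q: "q \<in> prob_simplex (cov L)" and T: "1 \<le> T"
  shows "(\<Sum>t=1..T. \<Sum>a'\<in>cov L. z t a' * p t a') \<le>
    (\<Sum>t=1..T. \<Sum>a'\<in>cov L. z t a' * q a') + treg T q +
    (\<Sum>t=1..T. 8 * (\<sigma> (j t))\<^sup>2 / ((\<delta> (j t))\<^sup>2 * rate t (j t)) / sqrt (tmass (p t) (j t) (anc_leaf (j t) (a t)))) +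
    (\<Sum>i=1..L. rate T i * sqrt (card (cov i)))"
proof -
  define m where "m t = tmass (p t) (j t) (anc_leaf (j t) (a t))" for t
  define stab where "stab t = 8 * (\<sigma> (j t))\<^sup>2 / ((\<delta> (j t))\<^sup>2 * rate t (j t)) / sqrt (m t)" for t
  define zp where "zp t q = (\<Sum>a'\<in>cov L. z t a' * q a')" for t and q :: "'a \<Rightarrow> real"
  \<comment> \<open>Minus the regularizer of level i per unit of rate, on the simplex.\<close>
  define H where "H i q = (\<Sum>v\<in>tnodes i. sqrt (tmass q i v)) - 1" for i and q :: "'a \<Rightarrow> real"
  have H: "0 \<le> H i q" "H i q \<le> sqrt (card (cov i))" if "q \<in> prob_simplex (cov L)" "i \<le> L" for i q
    unfolding H_def using one_le_sum_sqrt_mass[OF that] sum_sqrt_mass_le[OF that] by auto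
  have reg: "treg t q = - (\<Sum>i=1..L. rate t i * H i q)" if "q \<in> prob_simplex (cov L)" for t q
    unfolding regularizer_eq[OF that] H_def sum_negf[symmetric]
    by (intro sum.cong refl) (simp add: algebra_simps)
  have ps: "p t \<in> prob_simplex (cov L)" if "1 \<le> t" for t
    using minimizer_in_simplex[OF min[OF that]] .
  have obj: "objective (\<lambda>a. \<Sum>s=1..t - 1. z s a) t q = (\<Sum>s=1..t - 1. zp s q) + treg t q" for t q
    unfolding objective_def zp_def sum_distrib_right by (subst sum.swap) simp
  have stable: "(\<Sum>s=1..t - 1. zp s (p t)) + treg t (p t) + zp t (p t) - stab t
      \<le> (\<Sum>s=1..t - 1. zp s q) + treg t q + zp t q"
    if t: "1 \<le> t" and q: "q \<in> prob_simplex (cov L)" for t q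
  proof -
    define w where "w = (r1 t - r2 t + \<sigma> (j t)) / (\<delta> (j t) * m t)"
    have "0 < p t (a t)" using minimizer_pos[OF min[OF t] L a[OF t]] .
    then have m: "0 < m t" unfolding m_def using le_mass[OF ps[OF t] a[OF t], of "j t"] by linarith
    have d: "0 < \<delta> (j t)" using \<delta>_pos j t by simp
    have w: "0 \<le> w" "w \<le> 2 * \<sigma> (j t) / (\<delta> (j t) * m t)"
      unfolding w_def using range[OF t] m d by (auto intro!: divide_right_mono divide_nonneg_pos)
    have v: "anc_leaf (j t) (a t) \<in> tnodes (j t)" using nodes_eq[of "j t"] a[OF t] j[OF t] by auto
    have zp: "zp t q = w * tmass q (j t) (anc_leaf (j t) (a t))" for q
      unfolding zp_def z_def estimate_inner w_def m_def ..
    have e: "0 < rate t (j t)" using rate_pos j t by simp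
    \<comment> \<open>At the largest w the constants combine to \<open>2 * 2\<^sup>2 = 8\<close>,
      and the mass to the power 3/2 against its square leaves the inverse root in
      \<open>stab\<close>.\<close>
    have "2 * w\<^sup>2 * sqrt (m t) ^ 3 / rate t (j t)
       \<le> 2 * (2 * \<sigma> (j t) / (\<delta> (j t) * m t))\<^sup>2 * sqrt (m t) ^ 3 / rate t (j t)"
      using w m e by (intro divide_right_mono mult_right_mono mult_left_mono power_mono) auto
    also have "\<dots> = stab t"
    proof -
      define r where "r = sqrt (m t)"
      have r: "m t = r\<^sup>2" "0 < r" unfolding r_def using m by auto
      show ?thesis unfolding stab_def r_def[symmetric] unfolding r(1) using r(2) d e
        by (simp add: field_simps power2_eq_square power3_eq_cube)
    qed
    finally have "2 * w\<^sup>2 * sqrt (m t) ^ 3 / rate t (j t) \<le> stab t" .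
    with minimizer_stable[OF min[OF t] q j[OF t] v _ w(1)] m show ?thesis
      unfolding obj zp m_def by simp
  qed
  have "\<forall>q \<in> prob_simplex (cov L). (\<Sum>t=1..n. zp t (p t)) \<le>
    (\<Sum>t=1..n. zp t q) + treg n q + (\<Sum>t=1..n. stab t) + (\<Sum>i=1..L. rate n i * sqrt (card (cov i)))"
    if "1 \<le> n" for n
    using that
  proof (induction n rule: dec_induct)
    case base
    have "- treg 1 (p 1) \<le> (\<Sum>i=1..L. rate 1 i * sqrt (card (cov i)))"
      unfolding reg[OF ps[OF order_refl]] using H[OF ps[OF order_refl]] rate_pos
      by (auto intro!: sum_mono mult_left_mono simp: less_imp_le simp del: One_nat_def)
    then show ?case using stable[of 1] by fastforce
  next
    case (step n)
    show ?case
    proof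
      fix q assume q: "q \<in> prob_simplex (cov L)"
      have pn: "p (Suc n) \<in> prob_simplex (cov L)" using ps by simp
      \<comment> \<open>Raising the rates lowers the regularizer at the next iterate. The drop is
        bounded by the increments of the rates, which telescope over the rounds.\<close>
      have "treg n (p (Suc n)) - treg (Suc n) (p (Suc n))
          = (\<Sum>i=1..L. (rate (Suc n) i - rate n i) * H i (p (Suc n)))"
        unfolding reg[OF pn] by (simp add: left_diff_distrib sum_subtractf)
      also have "\<dots> \<le> (\<Sum>i=1..L. (rate (Suc n) i - rate n i) * sqrt (card (cov i)))"
        using H[OF pn] rate_mono[of _ n "Suc n"]
        by (intro sum_mono mult_left_mono) auto
      also have "\<dots> = (\<Sum>i=1..L. rate (Suc n) i * sqrt (card (cov i)))
          - (\<Sum>i=1..L. rate n i * sqrt (card (cov i)))"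
        by (simp add: left_diff_distrib sum_subtractf)
      finally show "(\<Sum>t=1..Suc n. zp t (p t)) \<le> (\<Sum>t=1..Suc n. zp t q) + treg (Suc n) q
         + (\<Sum>t=1..Suc n. stab t) + (\<Sum>i=1..L. rate (Suc n) i * sqrt (card (cov i)))"
        using stable[of "Suc n" q] step.IH[rule_format, OF pn] q by (simp del: One_nat_def)
    qed
  qed
  from this[OF T] q show ?thesis unfolding zp_def stab_def m_def by blast
qed

end

section \<open>Conditional independence\<close>

context sigma_finite_subalgebra
begin

text \<open>Integrals over the sets of \<open>F\<close> determine the nonnegative conditional
  expectation, so equality passes to every weight measurable for \<open>F\<close>, without any
  integrability to check.\<close>

lemma nn_integral_cong_on_subalgebra:
  assumes [measurable]: "f \<in> borel_measurable M" "g \<in> borel_measurable M" "h \<in> borel_measurable F"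
    and eq: "\<And>B. B \<in> sets F \<Longrightarrow> (\<integral>\<^sup>+x\<in>B. f x \<partial>M) = (\<integral>\<^sup>+x\<in>B. g x \<partial>M)"
  shows "(\<integral>\<^sup>+x. h x * f x \<partial>M) = (\<integral>\<^sup>+x. h x * g x \<partial>M)"
proof -
  have "AE x in M. nn_cond_exp M F g x = nn_cond_exp M F f x"
  proof (rule nn_cond_exp_charact)
    fix B assume B [measurable]: "B \<in> sets F"
    have "(\<integral>\<^sup>+x\<in>B. nn_cond_exp M F g x \<partial>M) = (\<integral>\<^sup>+x\<in>B. g x \<partial>M)"
      using nn_cond_exp_intg[of "indicator B" g] by (simp add: mult.commute)
    then show "(\<integral>\<^sup>+x\<in>B. f x \<partial>M) = (\<integral>\<^sup>+x\<in>B. nn_cond_exp M F g x \<partial>M)" using eq[OF B] by simp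
  qed auto
  then have "(\<integral>\<^sup>+x. h x * nn_cond_exp M F g x \<partial>M) = (\<integral>\<^sup>+x. h x * nn_cond_exp M F f x \<partial>M)"
    by (intro nn_integral_cong_AE) auto
  then show ?thesis by (simp add: nn_cond_exp_intg)
qed

text \<open>The pull-out property with an extended nonnegative weight, since inverse masses are not
  known to be integrable on their own.\<close>

lemma nn_integral_real_cond_exp:
  assumes f: "integrable M f" "\<And>x. 0 \<le> f x" and [measurable]: "h \<in> borel_measurable F"
  shows "(\<integral>\<^sup>+x. h x * ennreal (real_cond_exp M F f x) \<partial>M) = (\<integral>\<^sup>+x. h x * ennreal (f x) \<partial>M)"
proof (rule nn_integral_cong_on_subalgebra)
  have [measurable]: "f \<in> borel_measurable M" using f(1) by simp
  show "(\<lambda>x. ennreal (f x)) \<in> borel_measurable M" by measurable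
  show "(\<lambda>x. ennreal (real_cond_exp M F f x)) \<in> borel_measurable M" by measurable
  have nonneg: "AE x in M. 0 \<le> real_cond_exp M F f x"
    using f by (intro real_cond_exp_pos) auto
  fix B assume B: "B \<in> sets F"
  then have BM [measurable]: "B \<in> sets M" using subalg by (auto simp: subalgebra_def)
  have int: "integrable M (\<lambda>x. indicator B x * f x)"
    "integrable M (\<lambda>x. indicator B x * real_cond_exp M F f x)"
    using integrable_mult_indicator[OF BM f(1)]
      integrable_mult_indicator[OF BM real_cond_exp_int(1)[OF f(1)]] by auto
  have "(\<integral>\<^sup>+x\<in>B. ennreal (real_cond_exp M F f x) \<partial>M)
      = (\<integral>\<^sup>+x. ennreal (indicator B x * real_cond_exp M F f x) \<partial>M)"
    by (intro nn_integral_cong) (auto simp: indicator_def)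
  also have "\<dots> = ennreal (\<integral>x. indicator B x * real_cond_exp M F f x \<partial>M)"
    using nonneg int by (intro nn_integral_eq_integral) auto
  also have "\<dots> = ennreal (\<integral>x. indicator B x * f x \<partial>M)"
    using real_cond_exp_intA[OF f(1) B] by (simp add: set_lebesgue_integral_def)
  also have "\<dots> = (\<integral>\<^sup>+x. ennreal (indicator B x * f x) \<partial>M)"
    using f(2) int by (intro nn_integral_eq_integral[symmetric]) auto
  also have "\<dots> = (\<integral>\<^sup>+x\<in>B. ennreal (f x) \<partial>M)"
    by (intro nn_integral_cong) (auto simp: indicator_def)
  finally show "(\<integral>\<^sup>+x\<in>B. ennreal (real_cond_exp M F f x) \<partial>M) = (\<integral>\<^sup>+x\<in>B. ennreal (f x) \<partial>M)" .
qed fact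

end

context prob_space
begin

lemma sigma_finite_subalgebraI: "subalgebra M G \<Longrightarrow> sigma_finite_subalgebra M G"
  by (rule finite_measure_subalgebra_is_sigma_finite)
    (simp add: finite_measure_subalgebra_def finite_measure_subalgebra_axioms_def finite_measure_axioms)

context
  fixes G N H :: "'a measure" and C :: "'a set"
  assumes G: "subalgebra M G" and N: "subalgebra M N" and indep: "cond_indep M G N H"
    and CH: "C \<in> sets H" and CM [measurable]: "C \<in> events"
begin

interpretation G: sigma_finite_subalgebra M G using G by (rule sigma_finite_subalgebraI)
interpretation N: sigma_finite_subalgebra M N using N by (rule sigma_finite_subalgebraI)

text \<open>The weights \<open>h\<close> and \<open>Y\<close> are measurable for two algebras,
  neither of which need contain the other. Hence two passes: \<open>h\<close> is carried along while
  testing on sets of \<open>N\<close>, where conditional independence factors the probability, and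
  only then is the test set replaced by \<open>Y\<close>.\<close>

lemma nn_integral_cond_indep:
  assumes [measurable]: "h \<in> borel_measurable G" "Y \<in> borel_measurable N"
  shows "(\<integral>\<^sup>+x. Y x * (h x * ennreal (indicator C x)) \<partial>M)
    = (\<integral>\<^sup>+x. Y x * (h x * ennreal (real_cond_exp M G (indicator C) x)) \<partial>M)"
proof (rule N.nn_integral_cong_on_subalgebra)
  have [measurable]: "h \<in> borel_measurable M" by (rule measurable_from_subalg[OF G]) simp
  show "(\<lambda>x. h x * ennreal (indicator C x)) \<in> borel_measurable M" by measurable
  show "(\<lambda>x. h x * ennreal (real_cond_exp M G (indicator C) x)) \<in> borel_measurable M" by measurable
  fix B assume B: "B \<in> sets N"
  then have BM [measurable]: "B \<in> events" using N by (auto simp: subalgebra_def)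
  have i: "integrable M (indicator D :: 'a \<Rightarrow> real)" if "D \<in> events" for D
    using that by (simp add: integrable_indicator_iff less_top[symmetric])
  have "AE x in M. 0 \<le> real_cond_exp M G (indicator B) x"
    by (intro G.real_cond_exp_pos) auto
  moreover have "AE x in M. 0 \<le> real_cond_exp M G (indicator C) x"
    by (intro G.real_cond_exp_pos) auto
  moreover have "AE x in M. real_cond_exp M G (indicator (B \<inter> C)) x
      = real_cond_exp M G (indicator B) x * real_cond_exp M G (indicator C) x"
    using indep B CH unfolding cond_indep_def by blast
  ultimately have ae: "AE x in M. ennreal (real_cond_exp M G (indicator (B \<inter> C)) x)
      = ennreal (real_cond_exp M G (indicator C) x) * ennreal (real_cond_exp M G (indicator B) x)"
    by eventually_elim (simp add: ennreal_mult mult.commute)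
  have "(\<integral>\<^sup>+x\<in>B. (h x * ennreal (indicator C x)) \<partial>M)
      = (\<integral>\<^sup>+x. h x * ennreal (indicator (B \<inter> C) x) \<partial>M)"
    by (intro nn_integral_cong) (auto simp: indicator_def)
  also have "\<dots> = (\<integral>\<^sup>+x. h x * ennreal (real_cond_exp M G (indicator (B \<inter> C)) x) \<partial>M)"
    by (intro G.nn_integral_real_cond_exp[symmetric]) (auto intro!: i)
  also have "\<dots> = (\<integral>\<^sup>+x. (h x * ennreal (real_cond_exp M G (indicator C) x))
      * ennreal (real_cond_exp M G (indicator B) x) \<partial>M)"
    using ae by (intro nn_integral_cong_AE) (auto simp: mult.assoc)
  \<comment> \<open>The pull-out property in reverse: the weight, now including the conditional
    probability of \<open>C\<close>, is still measurable for \<open>G\<close>.\<close>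
  also have "\<dots> = (\<integral>\<^sup>+x. (h x * ennreal (real_cond_exp M G (indicator C) x)) * ennreal (indicator B x) \<partial>M)"
    by (intro G.nn_integral_real_cond_exp) (auto intro!: i)
  also have "\<dots> = (\<integral>\<^sup>+x\<in>B. (h x * ennreal (real_cond_exp M G (indicator C) x)) \<partial>M)"
    by (intro nn_integral_cong) (auto simp: indicator_def)
  finally show "(\<integral>\<^sup>+x\<in>B. (h x * ennreal (indicator C x)) \<partial>M)
     = (\<integral>\<^sup>+x\<in>B. (h x * ennreal (real_cond_exp M G (indicator C) x)) \<partial>M)" .
qed fact

lemma integral_cond_indep_nonneg:
  fixes h Y :: "'a \<Rightarrow> real"
  assumes [measurable]: "h \<in> borel_measurable G" "Y \<in> borel_measurable N"
    and pos: "\<And>x. 0 \<le> h x" "\<And>x. 0 \<le> Y x"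
    and int: "integrable M (\<lambda>x. h x * real_cond_exp M G (indicator C) x * Y x)"
  shows "integrable M (\<lambda>x. h x * indicator C x * Y x)"
    and "(\<integral>x. h x * indicator C x * Y x \<partial>M)
       = (\<integral>x. h x * real_cond_exp M G (indicator C) x * Y x \<partial>M)"
proof -
  have [measurable]: "h \<in> borel_measurable M" by (rule measurable_from_subalg[OF G]) simp
  have [measurable]: "Y \<in> borel_measurable M" by (rule measurable_from_subalg[OF N]) simp
  have ae: "AE x in M. 0 \<le> real_cond_exp M G (indicator C) x"
    by (intro G.real_cond_exp_pos) auto
  have "(\<integral>\<^sup>+x. ennreal (h x * indicator C x * Y x) \<partial>M)
      = (\<integral>\<^sup>+x. ennreal (Y x) * (ennreal (h x) * ennreal (indicator C x)) \<partial>M)"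
    using pos by (intro nn_integral_cong) (auto simp: indicator_def ennreal_mult mult.commute)
  also have "\<dots> = (\<integral>\<^sup>+x. ennreal (Y x) * (ennreal (h x) * ennreal (real_cond_exp M G (indicator C) x)) \<partial>M)"
    by (rule nn_integral_cond_indep) measurable
  also have "\<dots> = (\<integral>\<^sup>+x. ennreal (h x * real_cond_exp M G (indicator C) x * Y x) \<partial>M)"
    using ae pos by (intro nn_integral_cong_AE) (auto simp: ennreal_mult mult.commute)
  also have "\<dots> = ennreal (\<integral>x. h x * real_cond_exp M G (indicator C) x * Y x \<partial>M)"
    using ae pos int by (intro nn_integral_eq_integral) auto
  finally have eq: "(\<integral>\<^sup>+x. ennreal (h x * indicator C x * Y x) \<partial>M)
      = ennreal (\<integral>x. h x * real_cond_exp M G (indicator C) x * Y x \<partial>M)" .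
  have ge: "0 \<le> (\<integral>x. h x * real_cond_exp M G (indicator C) x * Y x \<partial>M)"
    using ae pos by (intro integral_nonneg_AE) auto
  from nn_integral_eq_integrable[THEN iffD1, OF _ _ ge eq] pos
  show "integrable M (\<lambda>x. h x * indicator C x * Y x)"
    and "(\<integral>x. h x * indicator C x * Y x \<partial>M)
       = (\<integral>x. h x * real_cond_exp M G (indicator C) x * Y x \<partial>M)" by auto
qed

text \<open>Integrability is asked of the product with the conditional probability, where an
  unbounded weight can be tamed. With the indicator it is a conclusion.\<close>

lemma integral_cond_indep:
  fixes h Y :: "'a \<Rightarrow> real"
  assumes [measurable]: "h \<in> borel_measurable G" "Y \<in> borel_measurable N"
    and int: "integrable M (\<lambda>x. h x * real_cond_exp M G (indicator C) x * Y x)"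
  shows "integrable M (\<lambda>x. h x * indicator C x * Y x)" (is ?I)
    and "(\<integral>x. h x * indicator C x * Y x \<partial>M)
       = (\<integral>x. h x * real_cond_exp M G (indicator C) x * Y x \<partial>M)" (is ?E)
proof -
  let ?k = "real_cond_exp M G (indicator C)"
  have [measurable]: "h \<in> borel_measurable M" by (rule measurable_from_subalg[OF G]) simp
  have [measurable]: "Y \<in> borel_measurable M" by (rule measurable_from_subalg[OF N]) simp
  \<comment> \<open>Positive part for \<open>True\<close>, negative part for \<open>False\<close>;
    the product then splits into four terms of the nonnegative case.\<close>
  define f :: "bool \<Rightarrow> real \<Rightarrow> real" where "f s u = (if s then max u 0 else max (- u) 0)" for s u
  have [measurable]: "f s \<in> borel_measurable borel" for s unfolding f_def by simp
  have f0: "0 \<le> f s u" "\<bar>f s u\<bar> \<le> \<bar>u\<bar>" for s u unfolding f_def by auto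
  have i: "integrable M (\<lambda>x. f s (h x) * ?k x * f s' (Y x))" for s s'
    using int
    by (rule Bochner_Integration.integrable_bound)
       (auto simp: abs_mult intro!: mult_mono mult_nonneg_nonneg f0(2))
  have j: "integrable M (\<lambda>x. f s (h x) * indicator C x * f s' (Y x))"
    and e: "(\<integral>x. f s (h x) * indicator C x * f s' (Y x) \<partial>M)
       = (\<integral>x. f s (h x) * ?k x * f s' (Y x) \<partial>M)" for s s'
    using f0(1) i[of s s'] by (auto intro!: integral_cond_indep_nonneg)
  have split: "h x * u * Y x = f True (h x) * u * f True (Y x) - f True (h x) * u * f False (Y x)
     - f False (h x) * u * f True (Y x) + f False (h x) * u * f False (Y x)" for x u
    unfolding f_def by (auto simp: max_def)
  show ?I unfolding split[of _ "indicator C _"] using j by auto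
  show ?E unfolding split[of _ "indicator C _"] split[of _ "?k _"] using i j e by auto
qed

end

end

section \<open>The game\<close>

context weighted_tree
begin

text \<open>The second action is one outcome of a conditional law, so the probability of the first
  two draws dominates. This upper bound is what absorbs the inverse masses later.\<close>

lemma draw_prob_bounds:
  assumes p: "p \<in> prob_simplex (cov L)" and p_pos: "\<And>a. a \<in> cov L \<Longrightarrow> 0 < p a"
    and a: "a \<in> cov L" and b: "b \<in> cov L" and j: "j \<in> {1..L}"
  shows "0 \<le> tdraw p a j b" "tdraw p a j b \<le> p a * \<delta> j"
proof -
  have d: "0 < \<delta> j" using \<delta>_pos j by simp
  have nonneg: "0 \<le> tdraw p a j b" if "b \<in> cov L" for b
    unfolding draw_prob_def using p_pos[OF a] p_pos[OF that] mass_nonneg[OF p] d by (simp add: less_imp_le)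
  then show "0 \<le> tdraw p a j b" using b .
  have "tdraw p a j b \<le> (\<Sum>b\<in>cov L. tdraw p a j b)"
    using nonneg b by (intro member_le_sum) auto
  then show "tdraw p a j b \<le> p a * \<delta> j" using sum_draw_prob_const[OF p p_pos a] by simp
qed

lemma \<delta>_le_1: "j \<in> {1..L} \<Longrightarrow> \<delta> j \<le> 1"
  using member_le_sum[of j "{1..L}" \<delta>] \<delta>_pos sum_\<delta> by (auto simp: less_imp_le)

end

text \<open>The geometry of the covers and of the nearest parents enters the game through
  \<open>loss_range\<close> alone.\<close>

locale two_point_ftrl_game =
  two_point_game M F A Loss y act1 lev act2 + weighted_tree cov par L a0 \<sigma> \<delta>
  for M :: "'w measure" and F A Loss y act1 lev act2
    and cov :: "nat \<Rightarrow> 'a set" and par L a0 \<sigma> \<delta> +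
  fixes p :: "nat \<Rightarrow> 'w \<Rightarrow> 'a \<Rightarrow> real"
  assumes ftrl: "two_point_ftrl M F cov par L \<sigma> \<delta> y act1 lev act2 p"
    and L_ge_1: "1 \<le> L"
    and leaves_subset: "cov L \<subseteq> A"
    and loss_range: "\<And>l a b j. l \<in> Loss \<Longrightarrow> a \<in> cov L \<Longrightarrow> b \<in> cov L \<Longrightarrow> j \<in> {1..L}
      \<Longrightarrow> anc_leaf (j - 1) a = anc_leaf (j - 1) b \<Longrightarrow> \<bar>l a - l b\<bar> \<le> \<sigma> j"
begin

section \<open>Moves and their conditional law given the past\<close>

definition "move t \<omega> = (act1 t \<omega>, lev t \<omega>, act2 t \<omega>)"

abbreviation "moves \<equiv> cov L \<times> {1..L} \<times> cov L"

definition "move_event t m = {\<omega> \<in> space M. move t \<omega> = m}"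

definition "move_prob t m = real_cond_exp M (F (t - 1)) (indicator (move_event t m))"

text \<open>A version of \<open>p\<close> that is measurable with respect to the past; \<open>p\<close> itself is
  only known to agree with it almost everywhere.\<close>

definition "past_p t \<omega> a =
  (if a \<in> cov L then \<Sum>j=1..L. \<Sum>b\<in>cov L. move_prob t (a, j, b) \<omega> else 0)"

lemma sum_moves:
  "(\<Sum>m\<in>moves. f m) = (\<Sum>a\<in>cov L. \<Sum>j=1..L. \<Sum>b\<in>cov L. f (a, j, b))"
  for f :: "'a \<times> nat \<times> 'a \<Rightarrow> real"
  by (simp add: sum.cartesian_product)

lemma move_in_moves: "1 \<le> t \<Longrightarrow> \<omega> \<in> space M \<Longrightarrow> move t \<omega> \<in> moves"
  using ftrl unfolding two_point_ftrl_def move_def by auto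

lemma p_minimizer:
  assumes "1 \<le> t" "\<omega> \<in> space M"
  shows "is_arg_min (objective (\<lambda>a. \<Sum>s=1..t - 1. testimate (p s \<omega>) (act1 s \<omega>) (lev s \<omega>)
    (y s \<omega> (act1 s \<omega>)) (y s \<omega> (act2 s \<omega>)) a) t) (\<lambda>q. q \<in> prob_simplex (cov L)) (p t \<omega>)"
proof (cases "t = 1")
  case True
  have "objective (\<lambda>a. 0) 1 = treg 1" unfolding objective_def by auto
  then show ?thesis using ftrl assms unfolding two_point_ftrl_def True by auto
next
  case False
  then obtain s where s: "t = s + 1" "1 \<le> s"
    using assms(1) by (intro that[of "t - 1"]) auto
  show ?thesis using ftrl assms(2) s unfolding two_point_ftrl_def objective_def[abs_def] by auto
qed

lemma p_in_simplex: "1 \<le> t \<Longrightarrow> \<omega> \<in> space M \<Longrightarrow> p t \<omega> \<in> prob_simplex (cov L)"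
  using minimizer_in_simplex[OF p_minimizer] .

lemma p_pos: "1 \<le> t \<Longrightarrow> \<omega> \<in> space M \<Longrightarrow> a \<in> cov L \<Longrightarrow> 0 < p t \<omega> a"
  using minimizer_pos[OF p_minimizer L_ge_1] .

lemma measurable_F_M: "f \<in> borel_measurable (F t) \<Longrightarrow> f \<in> borel_measurable M"
  by (rule measurable_from_subalg[OF F_subalgebra])

lemma move_event_meas: "1 \<le> t \<Longrightarrow> move_event t m \<in> events"
proof -
  assume t: "1 \<le> t"
  obtain a j b where m: "m = (a, j, b)" by (cases m)
  have fibre: "f -` {x} \<inter> space M \<in> events" if "f \<in> F t \<rightarrow>\<^sub>M count_space B" for f and B :: "'b set" and x
  proof -
    have f: "f \<in> M \<rightarrow>\<^sub>M count_space B" using that by (rule measurable_from_subalg[OF F_subalgebra])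
    then have "f -` ({x} \<inter> B) \<inter> space M \<in> events" by (rule measurable_sets) simp
    also have "f -` ({x} \<inter> B) \<inter> space M = f -` {x} \<inter> space M"
      using measurable_space[OF f] by auto
    finally show ?thesis .
  qed
  have "move_event t m = (act1 t -` {a} \<inter> space M) \<inter> (lev t -` {j} \<inter> space M) \<inter> (act2 t -` {b} \<inter> space M)"
    unfolding move_event_def move_def m by auto
  then show ?thesis
    using fibre[OF act1_measurable[OF t]] fibre[OF lev_measurable[OF t]] fibre[OF act2_measurable[OF t]]
    by auto
qed

lemma move_prob_eq:
  assumes "1 \<le> t"
  shows "AE \<omega> in M. \<forall>a\<in>cov L. \<forall>j\<in>{1..L}. \<forall>b\<in>cov L. move_prob t (a, j, b) \<omega> = tdraw (p t \<omega>) a j b"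
proof -
  have "AE \<omega> in M. move_prob t (a, j, b) \<omega> = tdraw (p t \<omega>) a j b"
    if "a \<in> cov L" "j \<in> {1..L}" "b \<in> cov L" for a j b
    using ftrl assms that unfolding two_point_ftrl_def move_prob_def move_event_def move_def by auto
  then show ?thesis by (intro AE_finite_allI) auto
qed

lemma past_p_eq:
  assumes "1 \<le> t"
  shows "AE \<omega> in M. past_p t \<omega> = p t \<omega>"
  using move_prob_eq[OF assms] AE_space
proof eventually_elim
  case (elim \<omega>)
  show ?case
  proof
    fix a
    show "past_p t \<omega> a = p t \<omega> a"
    proof (cases "a \<in> cov L")
      case True
      then show ?thesis unfolding past_p_def
        using elim draw_prob_fst[OF p_in_simplex p_pos, OF assms _ assms] by simp
    next
      case False
      then show ?thesis unfolding past_p_def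
        using p_in_simplex[OF assms elim(2)] by (simp add: prob_simplex_def)
    qed
  qed
qed

lemma past_p_measurable [measurable]: "(\<lambda>\<omega>. past_p t \<omega> a) \<in> borel_measurable (F (t - 1))"
  unfolding past_p_def move_prob_def by (cases "a \<in> cov L") auto

lemma past_mass_measurable [measurable]:
  "(\<lambda>\<omega>. tmass (past_p t \<omega>) j v) \<in> borel_measurable (F (t - 1))"
  unfolding mass_def by measurable

section \<open>Replacing a move by its conditional law\<close>

abbreviation "loss_algebra t \<equiv>
  vimage_algebra (space M) (\<lambda>\<omega>. restrict (y t \<omega>) A) (\<Pi>\<^sub>M a\<in>A. borel)"

lemma loss_algebra_subalgebra: "1 \<le> t \<Longrightarrow> subalgebra M (loss_algebra t)"
proof -
  assume t: "1 \<le> t"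
  have f: "(\<lambda>\<omega>. restrict (y t \<omega>) A) \<in> M \<rightarrow>\<^sub>M (\<Pi>\<^sub>M a\<in>A. borel)"
    using loss_measurable[OF t] by (intro measurable_restrict) (rule measurable_F_M)
  then have "sets (loss_algebra t) \<subseteq> events"
    by (subst sets_vimage_algebra2) (auto dest: measurable_space intro: measurable_sets)
  then show ?thesis by (simp add: subalgebra_def)
qed

lemma loss_measurable' [measurable]:
  assumes "a \<in> cov L"
  shows "(\<lambda>\<omega>. y t \<omega> a) \<in> borel_measurable (loss_algebra t)"
proof -
  have a: "a \<in> A" using assms leaves_subset by auto
  have "(\<lambda>\<omega>. restrict (y t \<omega>) A) \<in> loss_algebra t \<rightarrow>\<^sub>M (\<Pi>\<^sub>M a\<in>A. borel)"
    by (rule measurable_vimage_algebra1) (auto simp: space_PiM)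
  then have "(\<lambda>\<omega>. restrict (y t \<omega>) A a) \<in> borel_measurable (loss_algebra t)"
    using a by (rule measurable_compose[OF _ measurable_component_singleton])
  then show ?thesis using a by simp
qed

text \<open>There are finitely many moves, and for each one \<open>h\<close> is known from the past
  and \<open>Y\<close> from the loss, so conditional independence applies term by term. The bound
  concerns \<open>h\<close> times the probability of the move because \<open>h\<close> will contain
  inverse masses.\<close>

lemma integral_move:
  fixes h Y :: "'a \<times> nat \<times> 'a \<Rightarrow> 'w \<Rightarrow> real"
  assumes t: "1 \<le> t"
    and h: "\<And>m. m \<in> moves \<Longrightarrow> h m \<in> borel_measurable (F (t - 1))"
    and Y: "\<And>m. m \<in> moves \<Longrightarrow> Y m \<in> borel_measurable (loss_algebra t)"
    and int: "\<And>m. m \<in> moves \<Longrightarrow> integrable M (Y m)"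
    and bound: "\<And>m. m \<in> moves \<Longrightarrow> AE \<omega> in M. \<bar>h m \<omega> * move_prob t m \<omega>\<bar> \<le> B"
  shows "integrable M (\<lambda>\<omega>. h (move t \<omega>) \<omega> * Y (move t \<omega>) \<omega>)" (is ?I)
    and "integrable M (\<lambda>\<omega>. \<Sum>m\<in>moves. h m \<omega> * move_prob t m \<omega> * Y m \<omega>)" (is ?J)
    and "(\<integral>\<omega>. h (move t \<omega>) \<omega> * Y (move t \<omega>) \<omega> \<partial>M)
      = (\<integral>\<omega>. (\<Sum>m\<in>moves. h m \<omega> * move_prob t m \<omega> * Y m \<omega>) \<partial>M)" (is ?E)
proof -
  have eq: "h (move t \<omega>) \<omega> * Y (move t \<omega>) \<omega>
      = (\<Sum>m\<in>moves. h m \<omega> * indicator (move_event t m) \<omega> * Y m \<omega>)" if "\<omega> \<in> space M" for \<omega>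
  proof -
    have "(\<Sum>m\<in>moves. h m \<omega> * indicator (move_event t m) \<omega> * Y m \<omega>)
        = (\<Sum>m\<in>moves. if m = move t \<omega> then h m \<omega> * Y m \<omega> else 0)"
      using that by (intro sum.cong refl) (auto simp: move_event_def)
    then show ?thesis using move_in_moves[OF t that] by simp
  qed
  have one: "integrable M (\<lambda>\<omega>. h m \<omega> * move_prob t m \<omega> * Y m \<omega>)"
    "integrable M (\<lambda>\<omega>. h m \<omega> * indicator (move_event t m) \<omega> * Y m \<omega>)"
    "(\<integral>\<omega>. h m \<omega> * indicator (move_event t m) \<omega> * Y m \<omega> \<partial>M)
      = (\<integral>\<omega>. h m \<omega> * move_prob t m \<omega> * Y m \<omega> \<partial>M)" if m: "m \<in> moves" for m
  proof -
    have [measurable]: "h m \<in> borel_measurable M" "Y m \<in> borel_measurable M"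
      using measurable_F_M[OF h[OF m]] int[OF m] by auto
    have [measurable]: "move_prob t m \<in> borel_measurable M" unfolding move_prob_def by measurable
    have B: "integrable M (\<lambda>\<omega>. B * Y m \<omega>)" using int[OF m] by simp
    show int': "integrable M (\<lambda>\<omega>. h m \<omega> * move_prob t m \<omega> * Y m \<omega>)"
    proof (rule Bochner_Integration.integrable_bound[OF B])
      show "AE \<omega> in M. norm (h m \<omega> * move_prob t m \<omega> * Y m \<omega>) \<le> norm (B * Y m \<omega>)"
        using bound[OF m]
      proof eventually_elim
        case (elim \<omega>)
        then have "\<bar>h m \<omega> * move_prob t m \<omega>\<bar> * \<bar>Y m \<omega>\<bar> \<le> \<bar>B\<bar> * \<bar>Y m \<omega>\<bar>"
          by (intro mult_right_mono) auto
        then show ?case by (simp add: abs_mult)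
      qed
    qed measurable
    let ?H = "count_space A \<Otimes>\<^sub>M (count_space UNIV \<Otimes>\<^sub>M count_space A)"
    obtain a j b where m': "m = (a, j, b)" "a \<in> A" "b \<in> A" using m leaves_subset by auto
    \<comment> \<open>The event of a single move is the preimage of a measurable rectangle, as
      conditional independence requires; leaves lie in \<open>A\<close>.\<close>
    have "{a} \<times> {j} \<times> {b} \<in> sets ?H" using m' by (intro pair_measureI) auto
    then have "(\<lambda>\<omega>. (act1 t \<omega>, lev t \<omega>, act2 t \<omega>)) -` ({a} \<times> {j} \<times> {b}) \<inter> space M
        \<in> sets (vimage_algebra (space M) (\<lambda>\<omega>. (act1 t \<omega>, lev t \<omega>, act2 t \<omega>)) ?H)"
      by (rule in_vimage_algebra)
    also have "(\<lambda>\<omega>. (act1 t \<omega>, lev t \<omega>, act2 t \<omega>)) -` ({a} \<times> {j} \<times> {b}) \<inter> space M = move_event t m"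
      unfolding move_event_def move_def m' by auto
    finally have C: "move_event t m \<in> sets (vimage_algebra (space M) (\<lambda>\<omega>. (act1 t \<omega>, lev t \<omega>, act2 t \<omega>)) ?H)" .
    note indep = integral_cond_indep[OF F_subalgebra loss_algebra_subalgebra[OF t] loss_indep_move[OF t]
        C move_event_meas[OF t] h[OF m] Y[OF m] int'[unfolded move_prob_def]]
    show "integrable M (\<lambda>\<omega>. h m \<omega> * indicator (move_event t m) \<omega> * Y m \<omega>)"
      "(\<integral>\<omega>. h m \<omega> * indicator (move_event t m) \<omega> * Y m \<omega> \<partial>M)
      = (\<integral>\<omega>. h m \<omega> * move_prob t m \<omega> * Y m \<omega> \<partial>M)"
      using indep unfolding move_prob_def by auto
  qed
  show ?J using one by (intro Bochner_Integration.integrable_sum) auto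
  have "integrable M (\<lambda>\<omega>. \<Sum>m\<in>moves. h m \<omega> * indicator (move_event t m) \<omega> * Y m \<omega>)"
    using one by (intro Bochner_Integration.integrable_sum) auto
  then show ?I using eq by (simp cong: Bochner_Integration.integrable_cong)
  have "(\<integral>\<omega>. h (move t \<omega>) \<omega> * Y (move t \<omega>) \<omega> \<partial>M)
      = (\<integral>\<omega>. (\<Sum>m\<in>moves. h m \<omega> * indicator (move_event t m) \<omega> * Y m \<omega>) \<partial>M)"
    using eq by (intro Bochner_Integration.integral_cong) auto
  also have "\<dots> = (\<integral>\<omega>. (\<Sum>m\<in>moves. h m \<omega> * move_prob t m \<omega> * Y m \<omega>) \<partial>M)"
    using one by (subst (1 2) Bochner_Integration.integral_sum) auto
  finally show ?E .
qed

lemma move_prob_bounds: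
  assumes "1 \<le> t"
  shows "AE \<omega> in M. p t \<omega> = past_p t \<omega> \<and> (\<forall>a\<in>cov L. \<forall>j\<in>{1..L}. \<forall>b\<in>cov L.
    move_prob t (a, j, b) \<omega> = tdraw (p t \<omega>) a j b \<and>
    0 \<le> move_prob t (a, j, b) \<omega> \<and> move_prob t (a, j, b) \<omega> \<le> p t \<omega> a * \<delta> j)"
  using move_prob_eq[OF assms] past_p_eq[OF assms] AE_space
proof eventually_elim
  case (elim \<omega>)
  then show ?case
    using draw_prob_bounds[OF p_in_simplex[OF assms elim(3)] p_pos[OF assms elim(3)]] by simp
qed

lemma leaf_loss_integrable: "1 \<le> t \<Longrightarrow> a \<in> cov L \<Longrightarrow> integrable M (\<lambda>\<omega>. y t \<omega> a)"
  using loss_integrable leaves_subset by auto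

section \<open>Expectations of the quantities of one round\<close>

definition est_regret :: "nat \<Rightarrow> 'a \<Rightarrow> 'w \<Rightarrow> real" where
  "est_regret t b \<omega> = (\<Sum>a\<in>cov L. testimate (past_p t \<omega>) (act1 t \<omega>) (lev t \<omega>)
     (y t \<omega> (act1 t \<omega>)) (y t \<omega> (act2 t \<omega>)) a * (past_p t \<omega> a - of_bool (a = b)))"

definition stab :: "nat \<Rightarrow> 'w \<Rightarrow> real" where
  "stab t \<omega> = 8 * (\<sigma> (lev t \<omega>))\<^sup>2 / ((\<delta> (lev t \<omega>))\<^sup>2 * rate t (lev t \<omega>))
     / sqrt (tmass (past_p t \<omega>) (lev t \<omega>) (anc_leaf (lev t \<omega>) (act1 t \<omega>)))"

text \<open>Once the move is replaced by its conditional law, only a finite sum is left at almost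
  every outcome. The deterministic identities for a fixed loss vector then apply with the realized
  loss, even though that loss is not known from the past.\<close>

lemma expected_round:
  assumes t: "1 \<le> t" and b': "b' \<in> cov L"
  shows "integrable M (\<lambda>\<omega>. y t \<omega> (act1 t \<omega>))"
    and "integrable M (\<lambda>\<omega>. y t \<omega> (act2 t \<omega>))"
    and "integrable M (est_regret t b')"
    and "(\<integral>\<omega>. (y t \<omega> (act1 t \<omega>) + y t \<omega> (act2 t \<omega>)) / 2 - y t \<omega> b' \<partial>M) = (\<integral>\<omega>. est_regret t b' \<omega> \<partial>M)"
proof -
  note [measurable] = loss_measurable'
  have b1: "AE \<omega> in M. \<bar>1 * move_prob t m \<omega>\<bar> \<le> 1" if m: "m \<in> moves" for m
    using move_prob_bounds[OF t] AE_space
  proof eventually_elim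
    case (elim \<omega>)
    obtain a j b where m': "m = (a, j, b)" "a \<in> cov L" "j \<in> {1..L}" "b \<in> cov L" using m by auto
    have "p t \<omega> a * \<delta> j \<le> 1 * 1"
      using le_mass[OF p_in_simplex[OF t elim(2)] m'(2), of j]
        mass_le_1[OF p_in_simplex[OF t elim(2)], of j "anc_leaf j a"] \<delta>_le_1[OF m'(3)] \<delta>_pos[OF m'(3)]
      by (intro mult_mono) auto
    moreover have "0 \<le> move_prob t m \<omega>" "move_prob t m \<omega> \<le> p t \<omega> a * \<delta> j"
      using elim(1) m'(2-4) unfolding m'(1) by blast+
    ultimately show ?case by simp
  qed
  let ?Y1 = "\<lambda>(a, j, b) \<omega>. y t \<omega> a" and ?Y2 = "\<lambda>(a, j, b) \<omega>. y t \<omega> b"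
  let ?Y = "\<lambda>(a, j, b) \<omega>. y t \<omega> a - y t \<omega> b + \<sigma> j"
  let ?h = "\<lambda>(a, j, b) \<omega>. (tmass (past_p t \<omega>) j (anc_leaf j a) - of_bool (anc_leaf j b' = anc_leaf j a))
     / (\<delta> j * tmass (past_p t \<omega>) j (anc_leaf j a))"
  note i1 = integral_move[of t "\<lambda>_ _. 1" ?Y1 1, OF t _ _ _ b1]
  note i2 = integral_move[of t "\<lambda>_ _. 1" ?Y2 1, OF t _ _ _ b1]
  have I1: "integrable M (\<lambda>\<omega>. y t \<omega> (act1 t \<omega>))"
    "integrable M (\<lambda>\<omega>. \<Sum>m\<in>moves. 1 * move_prob t m \<omega> * ?Y1 m \<omega>)"
    "(\<integral>\<omega>. y t \<omega> (act1 t \<omega>) \<partial>M) = (\<integral>\<omega>. (\<Sum>m\<in>moves. 1 * move_prob t m \<omega> * ?Y1 m \<omega>) \<partial>M)"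
    using i1[unfolded move_def] leaf_loss_integrable[OF t] loss_measurable' by (auto simp: split_beta)
  have I2: "integrable M (\<lambda>\<omega>. y t \<omega> (act2 t \<omega>))"
    "integrable M (\<lambda>\<omega>. \<Sum>m\<in>moves. 1 * move_prob t m \<omega> * ?Y2 m \<omega>)"
    "(\<integral>\<omega>. y t \<omega> (act2 t \<omega>) \<partial>M) = (\<integral>\<omega>. (\<Sum>m\<in>moves. 1 * move_prob t m \<omega> * ?Y2 m \<omega>) \<partial>M)"
    using i2[unfolded move_def] leaf_loss_integrable[OF t] loss_measurable' by (auto simp: split_beta)
  show "integrable M (\<lambda>\<omega>. y t \<omega> (act1 t \<omega>))" "integrable M (\<lambda>\<omega>. y t \<omega> (act2 t \<omega>))"
    by fact+
  have est: "est_regret t b' = (\<lambda>\<omega>. ?h (move t \<omega>) \<omega> * ?Y (move t \<omega>) \<omega>)"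
    unfolding est_regret_def estimate_inner mass_diff mass_point[OF b'] move_def by auto
  have bh: "AE \<omega> in M. \<bar>?h m \<omega> * move_prob t m \<omega>\<bar> \<le> 1" if m: "m \<in> moves" for m
    using move_prob_bounds[OF t] AE_space
  proof eventually_elim
    case (elim \<omega>)
    obtain a j b where m': "m = (a, j, b)" "a \<in> cov L" "j \<in> {1..L}" "b \<in> cov L" using m by auto
    have mp: "past_p t \<omega> = p t \<omega>" "0 \<le> move_prob t m \<omega>" "move_prob t m \<omega> \<le> p t \<omega> a * \<delta> j"
      using elim(1)[THEN conjunct1] elim(1)[THEN conjunct2, rule_format, OF m'(2-4)] m'(1) by simp_all
    define x where "x = tmass (p t \<omega>) j (anc_leaf j a)"
    have p: "p t \<omega> \<in> prob_simplex (cov L)" using p_in_simplex[OF t elim(2)] .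
    have x: "p t \<omega> a \<le> x" "x \<le> 1" "0 < p t \<omega> a"
      unfolding x_def using le_mass[OF p m'(2)] mass_le_1[OF p] p_pos[OF t elim(2) m'(2)] by auto
    have d: "0 < \<delta> j" using \<delta>_pos m' by simp
    let ?o = "of_bool (anc_leaf j b' = anc_leaf j a) :: real"
    have "\<bar>(x - ?o) / (\<delta> j * x) * move_prob t m \<omega>\<bar> = \<bar>x - ?o\<bar> / (\<delta> j * x) * move_prob t m \<omega>"
      using mp(2) x d by (simp add: abs_mult)
    \<comment> \<open>The numerator has modulus at most 1, and since the leaf has at most the mass x
      of its node, the probability of the draw cancels the denominator.\<close>
    also have "\<dots> \<le> 1 / (\<delta> j * x) * (x * \<delta> j)"
    proof (intro mult_mono divide_right_mono)
      show "move_prob t m \<omega> \<le> x * \<delta> j"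
        using mp(3) x d by (meson mult_right_mono less_imp_le order_trans)
    qed (use mp(2) x d in \<open>auto simp: of_bool_def\<close>)
    also have "\<dots> = 1" using x d by simp
    finally show ?case using mp(1) m'(1) unfolding x_def by simp
  qed
  have hm: "?h m \<in> borel_measurable (F (t - 1))" for m
    by (cases m) (auto simp only: prod.case intro!: borel_measurable_divide borel_measurable_diff
      borel_measurable_times borel_measurable_const past_mass_measurable)
  have Ym: "?Y m \<in> borel_measurable (loss_algebra t)" if "m \<in> moves" for m
    using that by (auto intro!: borel_measurable_add borel_measurable_diff loss_measurable')
  have Yi: "integrable M (?Y m)" if "m \<in> moves" for m
    using that leaf_loss_integrable[OF t] by auto
  note I = integral_move[of t ?h ?Y 1, OF t hm Ym Yi bh, folded est]
  have I3a: "integrable M (est_regret t b')" by (rule I(1))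
  have I3b: "integrable M (\<lambda>\<omega>. \<Sum>m\<in>moves. ?h m \<omega> * move_prob t m \<omega> * ?Y m \<omega>)"
    by (rule I(2))
  have I3c: "(\<integral>\<omega>. est_regret t b' \<omega> \<partial>M) = (\<integral>\<omega>. (\<Sum>m\<in>moves. ?h m \<omega> * move_prob t m \<omega> * ?Y m \<omega>) \<partial>M)"
    by (rule I(3))
  show "integrable M (est_regret t b')" by (rule I3a)
  have yb: "integrable M (\<lambda>\<omega>. y t \<omega> b')" using leaf_loss_integrable[OF t b'] .
  have lin: "(\<integral>\<omega>. (f1 \<omega> + f2 \<omega>) / 2 - g \<omega> - f3 \<omega> \<partial>M)
      = ((\<integral>\<omega>. f1 \<omega> \<partial>M) + (\<integral>\<omega>. f2 \<omega> \<partial>M)) / 2 - (\<integral>\<omega>. g \<omega> \<partial>M) - (\<integral>\<omega>. f3 \<omega> \<partial>M)"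
    if "integrable M f1" "integrable M f2" "integrable M g" "integrable M f3"
    for f1 f2 f3 g :: "'w \<Rightarrow> real"
    using that by simp
  \<comment> \<open>Both actions average to the same mean loss, and the estimated regret to that
    mean minus the loss of \<open>b'\<close>, so the integrand vanishes almost everywhere.\<close>
  have zero: "(\<integral>\<omega>. ((\<Sum>m\<in>moves. 1 * move_prob t m \<omega> * ?Y1 m \<omega>) + (\<Sum>m\<in>moves. 1 * move_prob t m \<omega> * ?Y2 m \<omega>)) / 2
      - y t \<omega> b' - (\<Sum>m\<in>moves. ?h m \<omega> * move_prob t m \<omega> * ?Y m \<omega>) \<partial>M) = 0"
  proof (rule integral_eq_zero_AE)
    show "AE \<omega> in M. ((\<Sum>m\<in>moves. 1 * move_prob t m \<omega> * ?Y1 m \<omega>) + (\<Sum>m\<in>moves. 1 * move_prob t m \<omega> * ?Y2 m \<omega>)) / 2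
      - y t \<omega> b' - (\<Sum>m\<in>moves. ?h m \<omega> * move_prob t m \<omega> * ?Y m \<omega>) = 0"
      using move_prob_bounds[OF t] AE_space
    proof eventually_elim
      case (elim \<omega>)
      note P = p_in_simplex[OF t elim(2)] p_pos[OF t elim(2)]
      have "(\<Sum>m\<in>moves. 1 * move_prob t m \<omega> * ?Y1 m \<omega>) = (\<Sum>a\<in>cov L. p t \<omega> a * y t \<omega> a)"
      proof (rule trans[OF _ expected_fst[OF P]])
        show "(\<Sum>m\<in>moves. 1 * move_prob t m \<omega> * ?Y1 m \<omega>)
          = (\<Sum>a\<in>cov L. \<Sum>j=1..L. \<Sum>b\<in>cov L. tdraw (p t \<omega>) a j b * y t \<omega> a)"
          unfolding sum_moves using elim(1) by (intro sum.cong refl) simp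
      qed
      moreover have "(\<Sum>m\<in>moves. 1 * move_prob t m \<omega> * ?Y2 m \<omega>) = (\<Sum>a\<in>cov L. p t \<omega> a * y t \<omega> a)"
      proof (rule trans[OF _ expected_snd[OF P]])
        show "(\<Sum>m\<in>moves. 1 * move_prob t m \<omega> * ?Y2 m \<omega>)
          = (\<Sum>a\<in>cov L. \<Sum>j=1..L. \<Sum>b\<in>cov L. tdraw (p t \<omega>) a j b * y t \<omega> b)"
          unfolding sum_moves using elim(1) by (intro sum.cong refl) simp
      qed
      moreover have "(\<Sum>m\<in>moves. ?h m \<omega> * move_prob t m \<omega> * ?Y m \<omega>)
          = (\<Sum>a\<in>cov L. p t \<omega> a * y t \<omega> a) - y t \<omega> b'"
      proof (rule trans[OF _ expected_estimated_regret[OF P b']])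
        show "(\<Sum>m\<in>moves. ?h m \<omega> * move_prob t m \<omega> * ?Y m \<omega>)
          = (\<Sum>a\<in>cov L. \<Sum>j=1..L. \<Sum>b\<in>cov L. tdraw (p t \<omega>) a j b *
             (\<Sum>a'\<in>cov L. testimate (p t \<omega>) a j (y t \<omega> a) (y t \<omega> b) a' * (p t \<omega> a' - of_bool (a' = b'))))"
          unfolding sum_moves estimate_inner mass_diff mass_point[OF b']
          using elim(1) by (intro sum.cong refl) simp
      qed
      ultimately show ?case by simp
    qed
  qed
  note trans[OF lin[OF I1(2) I2(2) yb I3b, symmetric] zero, folded I1(3) I2(3) I3c]
  moreover have "(\<integral>\<omega>. (y t \<omega> (act1 t \<omega>) + y t \<omega> (act2 t \<omega>)) / 2 - y t \<omega> b' \<partial>M)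
      = ((\<integral>\<omega>. y t \<omega> (act1 t \<omega>) \<partial>M) + (\<integral>\<omega>. y t \<omega> (act2 t \<omega>) \<partial>M)) / 2 - (\<integral>\<omega>. y t \<omega> b' \<partial>M)"
    using I1(1) I2(1) yb by simp
  ultimately show "(\<integral>\<omega>. (y t \<omega> (act1 t \<omega>) + y t \<omega> (act2 t \<omega>)) / 2 - y t \<omega> b' \<partial>M)
      = (\<integral>\<omega>. est_regret t b' \<omega> \<partial>M)"
    by linarith
qed

lemma expected_stab:
  assumes t: "1 \<le> t"
  shows "integrable M (stab t)"
    and "(\<integral>\<omega>. stab t \<omega> \<partial>M) \<le> (\<Sum>j=1..L. 8 * (\<sigma> j)\<^sup>2 / (\<delta> j * rate t j) * sqrt (card (cov j)))"
proof -
  define C where "C j = 8 * (\<sigma> j)\<^sup>2 / ((\<delta> j)\<^sup>2 * rate t j)" for j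
  have C: "0 \<le> C j" if "j \<in> {1..L}" for j unfolding C_def using rate_pos[OF that, of t] by simp
  let ?h = "\<lambda>(a, j, b) \<omega>. C j / sqrt (tmass (past_p t \<omega>) j (anc_leaf j a))"
  have st: "stab t = (\<lambda>\<omega>. ?h (move t \<omega>) \<omega> * 1)" unfolding stab_def C_def move_def by auto
  \<comment> \<open>The sum over levels serves as one bound for all moves, as
    \<open>integral_move\<close> wants.\<close>
  have bh: "AE \<omega> in M. \<bar>?h m \<omega> * move_prob t m \<omega>\<bar> \<le> (\<Sum>j=1..L. C j)" if m: "m \<in> moves" for m
    using move_prob_bounds[OF t] AE_space
  proof eventually_elim
    case (elim \<omega>)
    obtain a j b where m': "m = (a, j, b)" "a \<in> cov L" "j \<in> {1..L}" "b \<in> cov L" using m by auto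
    have mp: "past_p t \<omega> = p t \<omega>" "0 \<le> move_prob t m \<omega>" "move_prob t m \<omega> \<le> p t \<omega> a * \<delta> j"
      using elim(1)[THEN conjunct1] elim(1)[THEN conjunct2, rule_format, OF m'(2-4)] m'(1) by simp_all
    define x where "x = tmass (p t \<omega>) j (anc_leaf j a)"
    have p: "p t \<omega> \<in> prob_simplex (cov L)" using p_in_simplex[OF t elim(2)] .
    have x: "p t \<omega> a \<le> x" "x \<le> 1" "0 < p t \<omega> a"
      unfolding x_def using le_mass[OF p m'(2)] mass_le_1[OF p] p_pos[OF t elim(2) m'(2)] by auto
    have d: "0 < \<delta> j" "\<delta> j \<le> 1" using \<delta>_pos \<delta>_le_1 m' by auto
    have "p t \<omega> a * \<delta> j \<le> x * 1" using x d by (intro mult_mono) auto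
    then have "move_prob t m \<omega> \<le> x" using mp(3) by linarith
    then have "C j / sqrt x * move_prob t m \<omega> \<le> C j / sqrt x * x"
      using C[OF m'(3)] x by (intro mult_left_mono) auto
    also have "\<dots> = C j * (x / sqrt x)" by simp
    also have "\<dots> = C j * sqrt x" using x by (subst real_div_sqrt) auto
    also have "\<dots> \<le> C j" using C[OF m'(3)] x by (intro mult_left_le) auto
    also have "\<dots> \<le> (\<Sum>j=1..L. C j)" using C m' by (intro member_le_sum) auto
    finally have "C j / sqrt x * move_prob t m \<omega> \<le> (\<Sum>j=1..L. C j)" .
    moreover have "0 \<le> C j / sqrt x * move_prob t m \<omega>" using C m'(3) x mp(2) by simp
    ultimately show ?case using mp(1) m'(1) unfolding x_def by simp
  qed
  have hm: "?h m \<in> borel_measurable (F (t - 1))" for m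
    by (cases m) (auto simp only: prod.case intro!: borel_measurable_divide borel_measurable_const
      measurable_compose[OF past_mass_measurable borel_measurable_sqrt])
  have one: "(\<lambda>_. 1 :: real) \<in> borel_measurable (loss_algebra t)" "integrable M (\<lambda>_. 1 :: real)"
    by simp_all
  note I = integral_move[of t ?h "\<lambda>_ _. 1" "\<Sum>j=1..L. C j", OF t hm one bh, folded st]
  show "integrable M (stab t)" by (rule I(1))
  have "(\<integral>\<omega>. stab t \<omega> \<partial>M) = (\<integral>\<omega>. (\<Sum>m\<in>moves. ?h m \<omega> * move_prob t m \<omega> * 1) \<partial>M)"
    by (rule I(3))
  also have "\<dots> \<le> (\<Sum>j=1..L. \<delta> j * C j * sqrt (card (cov j)))"
  proof (rule integral_le_const)
    show "integrable M (\<lambda>\<omega>. \<Sum>m\<in>moves. ?h m \<omega> * move_prob t m \<omega> * 1)" by (rule I(2))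
    show "AE \<omega> in M. (\<Sum>m\<in>moves. ?h m \<omega> * move_prob t m \<omega> * 1) \<le> (\<Sum>j=1..L. \<delta> j * C j * sqrt (card (cov j)))"
      using move_prob_bounds[OF t] AE_space
    proof eventually_elim
      case (elim \<omega>)
      have "(\<Sum>m\<in>moves. ?h m \<omega> * move_prob t m \<omega> * 1)
        = (\<Sum>a\<in>cov L. \<Sum>j=1..L. \<Sum>b\<in>cov L. ?h (a, j, b) \<omega> * move_prob t (a, j, b) \<omega> * 1)"
        by (rule sum_moves)
      also have "\<dots> = (\<Sum>a\<in>cov L. \<Sum>j=1..L. \<Sum>b\<in>cov L.
          tdraw (p t \<omega>) a j b * (C j / sqrt (tmass (p t \<omega>) j (anc_leaf j a))))"
        using elim(1) by (intro sum.cong refl) simp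
      finally show ?case
        using expected_stability[OF p_in_simplex[OF t elim(2)] p_pos[OF t elim(2)] C] by simp
    qed
  qed
  also have "\<dots> = (\<Sum>j=1..L. 8 * (\<sigma> j)\<^sup>2 / (\<delta> j * rate t j) * sqrt (card (cov j)))"
    unfolding C_def using \<delta>_pos by (intro sum.cong refl) (fastforce simp: power2_eq_square)
  finally show "(\<integral>\<omega>. stab t \<omega> \<partial>M) \<le> (\<Sum>j=1..L. 8 * (\<sigma> j)\<^sup>2 / (\<delta> j * rate t j) * sqrt (card (cov j)))" .
qed

text \<open>The common ancestor is prescribed only through conditional probabilities. An unrelated
  pair has conditional probability 0 almost everywhere, which integrates to a null event.\<close>

lemma second_action_related:
  assumes t: "1 \<le> t"
  shows "AE \<omega> in M. anc_leaf (lev t \<omega> - 1) (act1 t \<omega>) = anc_leaf (lev t \<omega> - 1) (act2 t \<omega>)"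
proof -
  have "AE \<omega> in M. \<omega> \<notin> move_event t (a, j, b)"
    if m: "a \<in> cov L" "j \<in> {1..L}" "b \<in> cov L" "anc_leaf (j - 1) a \<noteq> anc_leaf (j - 1) b" for a j b
  proof -
    interpret G: sigma_finite_subalgebra M "F (t - 1)" using F_subalgebra by (rule sigma_finite_subalgebraI)
    have C: "move_event t (a, j, b) \<in> events" using move_event_meas[OF t] .
    have "AE \<omega> in M. move_prob t (a, j, b) \<omega> = 0"
      using move_prob_eq[OF t]
      by eventually_elim (use m in \<open>auto simp: draw_prob_def same_anc_def\<close>)
    then have "(\<integral>\<omega>. move_prob t (a, j, b) \<omega> \<partial>M) = 0" by (rule integral_eq_zero_AE)
    moreover have "(\<integral>\<omega>. move_prob t (a, j, b) \<omega> \<partial>M) = (\<integral>\<omega>. indicator (move_event t (a, j, b)) \<omega> \<partial>M)"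
      unfolding move_prob_def using C
      by (intro G.real_cond_exp_int(2)) (simp add: integrable_indicator_iff less_top[symmetric])
    ultimately have "prob (move_event t (a, j, b)) = 0" using C by simp
    then show ?thesis using C by (intro AE_not_in null_setsI) (simp_all add: emeasure_eq_measure)
  qed
  then have "AE \<omega> in M. \<forall>a\<in>cov L. \<forall>j\<in>{1..L}. \<forall>b\<in>cov L.
     anc_leaf (j - 1) a \<noteq> anc_leaf (j - 1) b \<longrightarrow> \<omega> \<notin> move_event t (a, j, b)"
    by (intro AE_finite_allI) auto
  with AE_space show ?thesis
  proof eventually_elim
    case (elim \<omega>)
    then have "\<omega> \<in> move_event t (act1 t \<omega>, lev t \<omega>, act2 t \<omega>)"
      by (simp add: move_event_def move_def)
    moreover have "act1 t \<omega> \<in> cov L" "lev t \<omega> \<in> {1..L}" "act2 t \<omega> \<in> cov L"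
      using move_in_moves[OF t elim(1)] by (auto simp: move_def)
    ultimately show ?case using elim(2) by blast
  qed
qed

text \<open>Holds path by path off a countable union of null sets: there \<open>past_p\<close>
  agrees with \<open>p\<close>, and related actions satisfy the range condition of
  \<open>ftrl_regret\<close>. The point mass at \<open>b\<close> carries no regularizer.\<close>

lemma estimated_regret_bound:
  assumes T: "1 \<le> T" and b: "b \<in> cov L"
  shows "AE \<omega> in M. (\<Sum>t=1..T. est_regret t b \<omega>)
     \<le> (\<Sum>t=1..T. stab t \<omega>) + (\<Sum>j=1..L. rate T j * sqrt (card (cov j)))"
proof -
  have "AE \<omega> in M. \<forall>t. 1 \<le> t \<longrightarrow> anc_leaf (lev t \<omega> - 1) (act1 t \<omega>) = anc_leaf (lev t \<omega> - 1) (act2 t \<omega>)"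
    unfolding AE_all_countable using second_action_related by auto
  moreover have "AE \<omega> in M. \<forall>t. 1 \<le> t \<longrightarrow> past_p t \<omega> = p t \<omega>"
    unfolding AE_all_countable using past_p_eq by auto
  ultimately show ?thesis using AE_space
  proof eventually_elim
    case (elim \<omega>)
    have mv: "act1 t \<omega> \<in> cov L" "lev t \<omega> \<in> {1..L}" "act2 t \<omega> \<in> cov L" if "1 \<le> t" for t
      using move_in_moves[OF that elim(3)] by (auto simp: move_def)
    have range: "\<bar>y t \<omega> (act1 t \<omega>) - y t \<omega> (act2 t \<omega>)\<bar> \<le> \<sigma> (lev t \<omega>)" if t: "1 \<le> t" for t
      using loss_range[OF loss_in[OF t elim(3)] mv(1)[OF t] mv(3)[OF t] mv(2)[OF t]] elim(1) t by simp
    have "(\<Sum>t=1..T. est_regret t b \<omega>)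
      = (\<Sum>t=1..T. \<Sum>a\<in>cov L. testimate (p t \<omega>) (act1 t \<omega>) (lev t \<omega>) (y t \<omega> (act1 t \<omega>)) (y t \<omega> (act2 t \<omega>)) a * p t \<omega> a)
      - (\<Sum>t=1..T. \<Sum>a\<in>cov L. testimate (p t \<omega>) (act1 t \<omega>) (lev t \<omega>) (y t \<omega> (act1 t \<omega>)) (y t \<omega> (act2 t \<omega>)) a * of_bool (a = b))"
      unfolding est_regret_def sum_subtractf[symmetric] using elim(2)
      by (intro sum.cong refl) (simp add: algebra_simps)
    moreover have "(\<Sum>t=1..T. stab t \<omega>) = (\<Sum>t=1..T. 8 * (\<sigma> (lev t \<omega>))\<^sup>2 / ((\<delta> (lev t \<omega>))\<^sup>2 * rate t (lev t \<omega>))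
     / sqrt (tmass (p t \<omega>) (lev t \<omega>) (anc_leaf (lev t \<omega>) (act1 t \<omega>))))"
      unfolding stab_def using elim(2) by (intro sum.cong refl) simp
    ultimately show ?case
      using ftrl_regret[where p = "\<lambda>t. p t \<omega>" and a = "\<lambda>t. act1 t \<omega>" and j = "\<lambda>t. lev t \<omega>"
          and ?r1.0 = "\<lambda>t. y t \<omega> (act1 t \<omega>)" and ?r2.0 = "\<lambda>t. y t \<omega> (act2 t \<omega>)",
          OF L_ge_1 p_minimizer[OF _ elim(3)] mv(1,2) range point_in_prob_simplex[OF finite_leaves b] T]
      unfolding regularizer_point[OF b] by simp
  qed
qed

theorem leaf_regret_bound:
  assumes T: "1 \<le> T" and b: "b \<in> cov L"
  shows "(\<integral>\<omega>. (\<Sum>t=1..T. (y t \<omega> (act1 t \<omega>) + y t \<omega> (act2 t \<omega>)) / 2) \<partial>M) - (\<integral>\<omega>. (\<Sum>t=1..T. y t \<omega> b) \<partial>M)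
    \<le> (\<Sum>t=1..T. \<Sum>j=1..L. 8 * (\<sigma> j)\<^sup>2 / (\<delta> j * rate t j) * sqrt (card (cov j)))
      + (\<Sum>j=1..L. rate T j * sqrt (card (cov j)))"
proof -
  note E = expected_round[OF _ b]
  have "(\<integral>\<omega>. (\<Sum>t=1..T. (y t \<omega> (act1 t \<omega>) + y t \<omega> (act2 t \<omega>)) / 2) \<partial>M) - (\<integral>\<omega>. (\<Sum>t=1..T. y t \<omega> b) \<partial>M)
    = (\<Sum>t=1..T. \<integral>\<omega>. (y t \<omega> (act1 t \<omega>) + y t \<omega> (act2 t \<omega>)) / 2 - y t \<omega> b \<partial>M)"
    using E(1,2) leaf_loss_integrable[OF _ b]
    by (subst (1 2) Bochner_Integration.integral_sum) (auto simp: sum_subtractf)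
  also have "\<dots> = (\<Sum>t=1..T. \<integral>\<omega>. est_regret t b \<omega> \<partial>M)"
    using E(4) by (intro sum.cong refl) auto
  also have "\<dots> = (\<integral>\<omega>. (\<Sum>t=1..T. est_regret t b \<omega>) \<partial>M)"
    using E(3) by (subst Bochner_Integration.integral_sum) auto
  also have "\<dots> \<le> (\<integral>\<omega>. (\<Sum>t=1..T. stab t \<omega>) + (\<Sum>j=1..L. rate T j * sqrt (card (cov j))) \<partial>M)"
    using E(3) expected_stab(1) estimated_regret_bound[OF T b]
    by (intro integral_mono_AE Bochner_Integration.integrable_add
        Bochner_Integration.integrable_sum integrable_const) auto
  also have "\<dots> = (\<Sum>t=1..T. \<integral>\<omega>. stab t \<omega> \<partial>M) + (\<Sum>j=1..L. rate T j * sqrt (card (cov j)))"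
    using expected_stab(1) by (subst Bochner_Integration.integral_add) (auto simp: prob_space)
  also have "\<dots> \<le> (\<Sum>t=1..T. \<Sum>j=1..L. 8 * (\<sigma> j)\<^sup>2 / (\<delta> j * rate t j) * sqrt (card (cov j)))
      + (\<Sum>j=1..L. rate T j * sqrt (card (cov j)))"
    using expected_stab(2) by (intro add_right_mono sum_mono) auto
  finally show ?thesis .
qed

end

section \<open>Tuning\<close>

text \<open>Each term is at most twice an increment of the square root, and these telescope.\<close>

lemma sum_inverse_sqrt_le: "(\<Sum>t=1..T. 1 / sqrt (real t)) \<le> 2 * sqrt (real T)"
proof (induction T)
  case (Suc n)
  define u v where "u = sqrt (real n)" and "v = sqrt (real (Suc n))"
  have uv: "0 \<le> u" "u \<le> v" "0 < v" unfolding u_def v_def by auto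
  have "v * v - u * u = 1" unfolding u_def v_def by simp
  then have "2 * (v - u) * v - 1 = (v - u) * (v - u)" by (simp add: algebra_simps)
  then have "1 \<le> 2 * (v - u) * v" by (metis diff_ge_0_iff_ge zero_le_square)
  then have "1 / v \<le> 2 * (v - u)" using uv by (simp add: divide_le_eq)
  then show ?case using Suc unfolding u_def v_def by simp
qed simp

context weighted_tree
begin

text \<open>The factor 16 is 4 + 12, with 4 from stability and 12 from the penalty.\<close>

lemma regret_terms_le:
  assumes T: "1 \<le> T" and \<delta>T: "\<And>j. j \<in> {1..L} \<Longrightarrow> 1 / real T \<le> \<delta> j"
  shows "(\<Sum>t=1..T. \<Sum>j=1..L. 8 * (\<sigma> j)\<^sup>2 / (\<delta> j * rate t j) * sqrt (card (cov j)))
      + (\<Sum>j=1..L. rate T j * sqrt (card (cov j)))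
    \<le> 16 * sqrt (real T) * (\<Sum>j=1..L. \<sigma> j * sqrt (card (cov j)) / sqrt (\<delta> j))"
proof -
  define u where "u j = \<sigma> j * sqrt (card (cov j)) / sqrt (\<delta> j)" for j
  have u: "0 \<le> u j" if "j \<in> {1..L}" for j
    unfolding u_def using \<sigma>_pos[OF that] \<delta>_pos[OF that] by simp
  have s6: "2 \<le> sqrt 6" by (rule real_le_rsqrt) simp
  have "8 * (\<sigma> j)\<^sup>2 / (\<delta> j * rate t j) * sqrt (card (cov j)) \<le> 2 * u j * (1 / sqrt (real t))"
    if j: "j \<in> {1..L}" and t: "1 \<le> t" for j t
  proof -
    define d where "d = sqrt (\<delta> j)"
    have d: "0 < d" "\<delta> j = d * d" unfolding d_def using \<delta>_pos[OF j] by auto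
    have s: "0 < \<sigma> j" using \<sigma>_pos[OF j] .
    \<comment> \<open>Uses \<open>2 * sqrt 6 \<ge> 4\<close> and that the maximum in
      \<open>rate\<close> is at least t.\<close>
    have "4 * (\<sigma> j / d * sqrt (real t)) \<le> rate t j"
      unfolding rate_def d_def[symmetric] using s6 s d(1)
      by (intro mult_mono mult_left_mono real_sqrt_le_mono) auto
    then have "8 * (\<sigma> j)\<^sup>2 / (\<delta> j * rate t j) \<le> 8 * (\<sigma> j)\<^sup>2 / (\<delta> j * (4 * (\<sigma> j / d * sqrt (real t))))"
      using s d t rate_pos[OF j, of t] \<delta>_pos[OF j]
      by (intro divide_left_mono mult_left_mono mult_pos_pos) auto
    also have "\<dots> = 2 * \<sigma> j / d * (1 / sqrt (real t))"
      unfolding d(2) using s d(1) t by (simp add: field_simps power2_eq_square)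
    finally have "8 * (\<sigma> j)\<^sup>2 / (\<delta> j * rate t j) * sqrt (card (cov j))
      \<le> 2 * \<sigma> j / d * (1 / sqrt (real t)) * sqrt (card (cov j))"
      by (rule mult_right_mono) simp
    then show ?thesis unfolding u_def d_def by (simp add: mult_ac)
  qed
  then have "(\<Sum>t=1..T. \<Sum>j=1..L. 8 * (\<sigma> j)\<^sup>2 / (\<delta> j * rate t j) * sqrt (card (cov j)))
     \<le> (\<Sum>t=1..T. \<Sum>j=1..L. 2 * u j * (1 / sqrt (real t)))"
    by (intro sum_mono) auto
  also have "\<dots> = 2 * (\<Sum>j=1..L. u j) * (\<Sum>t=1..T. 1 / sqrt (real t))"
    unfolding sum_distrib_left sum_distrib_right ..
  also have "\<dots> \<le> 2 * (\<Sum>j=1..L. u j) * (2 * sqrt (real T))"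
    using u by (intro mult_left_mono sum_inverse_sqrt_le) (auto intro!: sum_nonneg)
  finally have 1: "(\<Sum>t=1..T. \<Sum>j=1..L. 8 * (\<sigma> j)\<^sup>2 / (\<delta> j * rate t j) * sqrt (card (cov j)))
     \<le> (\<Sum>j=1..L. u j) * (4 * sqrt (real T))" by simp
  have "rate T j * sqrt (card (cov j)) \<le> 12 * sqrt (real T) * u j" if j: "j \<in> {1..L}" for j
  proof -
    have d: "0 < \<delta> j" "1 \<le> real T * \<delta> j"
      using \<delta>_pos[OF j] \<delta>T[OF j] T by (auto simp: field_simps)
    \<comment> \<open>The lower bound on \<open>\<delta> j\<close> enters here. The resulting
      \<open>sqrt 6\<close> meets the one in \<open>rate\<close>, giving 2 * 6 = 12.\<close>
    have "max (real T) (6 / \<delta> j) \<le> 6 * real T" using d by (simp add: field_simps)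
    then have "sqrt (max (real T) (6 / \<delta> j)) \<le> sqrt 6 * sqrt (real T)"
      by (metis real_sqrt_le_mono real_sqrt_mult)
    then have "rate T j * sqrt (card (cov j))
      \<le> 2 * sqrt 6 * (\<sigma> j / sqrt (\<delta> j) * (sqrt 6 * sqrt (real T))) * sqrt (card (cov j))"
      unfolding rate_def using \<sigma>_pos[OF j] d(1) by (intro mult_right_mono mult_left_mono) auto
    also have "\<dots> = 2 * (sqrt 6 * sqrt 6) * sqrt (real T) * u j" unfolding u_def by (simp only: mult_ac times_divide_eq_left times_divide_eq_right)
    finally show ?thesis by simp
  qed
  then have 2: "(\<Sum>j=1..L. rate T j * sqrt (card (cov j))) \<le> 12 * sqrt (real T) * (\<Sum>j=1..L. u j)"
    unfolding sum_distrib_left by (rule sum_mono)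
  show ?thesis using 1 2 unfolding u_def by (simp add: algebra_simps)
qed

end

section \<open>The weights of the levels\<close>

lemma level_weight_pos: fixes cov :: "nat \<Rightarrow> 'a set"
  shows "finite (cov j) \<Longrightarrow> cov j \<noteq> {} \<Longrightarrow> 0 < level_weight cov j"
  unfolding level_weight_def by (simp add: card_gt_0_iff)

lemma level_scale_eq: "level_scale c j = 8 * c * 2 powr (- real j)"
  unfolding level_scale_def using powr_add[of 2 3 "- real j"] by simp

text \<open>The cube of the weight is \<open>2 powr (- 2 * j)\<close> times the size of the cover,
  so each summand of the bound becomes proportional to the weight itself. By Lagrange multipliers,
  probabilities proportional to these weights minimize the sum of
  \<open>level_scale c j * sqrt (card (cov j)) / sqrt (\<delta> j)\<close>.\<close>

lemma level_scale_sqrt_card: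
  fixes cov :: "nat \<Rightarrow> 'a set"
  assumes "finite (cov j)" "cov j \<noteq> {}" "0 < S"
  shows "level_scale c j * sqrt (card (cov j)) / sqrt (level_weight cov j / S)
    = 8 * c * sqrt S * level_weight cov j"
proof -
  let ?w = "level_weight cov j" and ?n = "real (card (cov j))"
  have w: "0 < ?w" using assms(1,2) by (rule level_weight_pos)
  have n: "0 < ?n" using assms by (simp add: card_gt_0_iff)
  have "((2::real) powr (- 2 * real j / 3)) ^ 3 = (2 powr (- real j))\<^sup>2"
    by (simp add: powr_power)
  moreover have "(?n powr (1 / 3)) ^ 3 = ?n" using n by (simp add: powr_power)
  ultimately have "?w ^ 3 = (2 powr (- real j))\<^sup>2 * ?n"
    unfolding level_weight_def by (simp only: power_mult_distrib)
  then have "sqrt (?w ^ 3) = 2 powr (- real j) * sqrt ?n" by (simp add: real_sqrt_mult)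
  moreover have "sqrt (?w ^ 3) = ?w * sqrt ?w"
    using w by (simp add: power3_eq_cube real_sqrt_mult)
  ultimately have "level_scale c j * sqrt ?n = 8 * c * ?w * sqrt ?w"
    unfolding level_scale_eq by simp
  then show ?thesis using w assms(3) by (simp add: real_sqrt_divide)
qed

lemma loss_dist_le:
  assumes "l \<in> Loss" "loss_dist Loss a b \<le> ennreal e" "0 \<le> e"
  shows "\<bar>l a - l b\<bar> \<le> e"
proof -
  have "ennreal \<bar>l a - l b\<bar> \<le> loss_dist Loss a b"
    unfolding loss_dist_def using assms(1) by (rule SUP_upper)
  then show ?thesis using assms by (meson order_trans ennreal_le_iff)
qed

section \<open>Regret against the whole action set\<close>

theorem corollary4:
  fixes A :: "'a set"
    and Loss :: "('a \<Rightarrow> real) set"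
    and c :: real
    and L T :: nat
    and a0 :: 'a
    and cov :: "nat \<Rightarrow> 'a set"
    and par :: "nat \<Rightarrow> 'a \<Rightarrow> 'a"
    and M :: "'w measure"
    and F :: "nat \<Rightarrow> 'w measure"
    and y p :: "nat \<Rightarrow> 'w \<Rightarrow> 'a \<Rightarrow> real"
    and act1 act2 :: "nat \<Rightarrow> 'w \<Rightarrow> 'a"
    and lev :: "nat \<Rightarrow> 'w \<Rightarrow> nat"
  assumes "c > 0"
    and "(SUP a\<in>A. SUP b\<in>A. loss_dist Loss a b) \<le> ennreal c"
    and "L \<ge> 1"
    and "a0 \<in> A"
    and "cov 0 = {a0}"
    and "\<And>j. j \<in> {1..L} \<Longrightarrow> finite (cov j) \<and> is_cover Loss A (c * 2 powr (- real j)) (cov j)"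
    and "nearest_parents Loss cov L par"
    and "two_point_game M F A Loss y act1 lev act2"
    and "two_point_ftrl M F cov par L (level_scale c) (level_dist cov L) y act1 lev act2 p"
    and "T \<ge> 1"
    and "Min (level_dist cov L ` {1..L}) \<ge> 1 / real T"
  shows "regret2 M A y act1 act2 T
    \<le> 16 * (9 + 4 * sqrt 6) * sqrt (K_eff c cov L * real T) + c * 2 powr (- real L) * real T"
proof -
  interpret two_point_game M F A Loss y act1 lev act2 by fact
  \<comment> \<open>Level 0 joins the covers: its radius is c, which bounds the diameter.\<close>
  have cover: "finite (cov j) \<and> is_cover Loss A (c * 2 powr (- real j)) (cov j)" if "j \<le> L" for j
  proof (cases "j = 0")
    case True
    have "loss_dist Loss a a0 \<le> ennreal c" if "a \<in> A" for a
    proof -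
      have "loss_dist Loss a a0 \<le> (SUP b\<in>A. loss_dist Loss a b)" using \<open>a0 \<in> A\<close> by (rule SUP_upper)
      also have "\<dots> \<le> (SUP a\<in>A. SUP b\<in>A. loss_dist Loss a b)" using that by (rule SUP_upper)
      finally show ?thesis using assms(2) by simp
    qed
    then show ?thesis using True assms(4,5) by (simp add: is_cover_def)
  qed (use assms(6) that in auto)
  have nonempty: "cov j \<noteq> {}" and sub: "cov j \<subseteq> A" and fin: "finite (cov j)" if "j \<le> L" for j
    using cover[OF that] \<open>a0 \<in> A\<close> unfolding is_cover_def by auto
  have par: "is_arg_min (loss_dist Loss a) (\<lambda>a'. a' \<in> cov (j - 1)) (par j a)"
    if "j \<in> {1..L}" "a \<in> cov j" for j a
    using assms(7) that unfolding nearest_parents_def by blast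
  interpret level_tree cov par L a0
    using fin nonempty \<open>cov 0 = {a0}\<close> par by unfold_locales (auto simp: is_arg_min_def)
  let ?S = "\<Sum>i=1..L. level_weight cov i"
  have w: "0 < level_weight cov j" if "j \<in> {1..L}" for j
    using that by (intro level_weight_pos fin nonempty) auto
  have S: "0 < ?S" using w \<open>L \<ge> 1\<close> by (intro sum_pos) auto
  interpret weighted_tree cov par L a0 "level_scale c" "level_dist cov L"
  proof
    show "0 < level_scale c j" for j unfolding level_scale_eq using \<open>c > 0\<close> by simp
    show "0 < level_dist cov L j" if "j \<in> {1..L}" for j
      unfolding level_dist_def using w[OF that] S by simp
    show "(\<Sum>j=1..L. level_dist cov L j) = 1"
      unfolding level_dist_def sum_divide_distrib[symmetric] using S by simp
  qed
  have par_dist: "\<bar>l a - l (par (Suc i) a)\<bar> \<le> c * 2 powr (- real i)"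
    if l: "l \<in> Loss" and i: "Suc i \<le> L" and a: "a \<in> cov (Suc i)" for l i a
  proof -
    have "a \<in> A" using sub[OF i] a by auto
    then obtain a' where a': "a' \<in> cov i" "loss_dist Loss a a' \<le> ennreal (c * 2 powr (- real i))"
      using cover[of i] i unfolding is_cover_def by auto
    have "\<not> loss_dist Loss a a' < loss_dist Loss a (par (Suc i) a)"
      using par[of "Suc i" a] i a a'(1) by (simp add: is_arg_min_def)
    then have "loss_dist Loss a (par (Suc i) a) \<le> ennreal (c * 2 powr (- real i))"
      using a'(2) by simp
    with l show ?thesis by (rule loss_dist_le) (use \<open>c > 0\<close> in simp)
  qed
  \<comment> \<open>The geometric series of the radii of levels j to i - 1 in closed form; keeping
    the subtracted term lets the induction close.\<close>
  have anc_dist: "\<bar>l a - l (anc par j i a)\<bar> \<le> 2 * c * (2 powr (- real j) - 2 powr (- real i))"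
    if l: "l \<in> Loss" and "j \<le> i" "i \<le> L" "a \<in> cov i" for l i j a
    using that(2-)
  proof (induction i arbitrary: a)
    case (Suc i)
    show ?case
    proof (cases "j = Suc i")
      case False
      then have j: "j \<le> i" using Suc.prems by simp
      have half: "2 powr (- real (Suc i)) = 2 powr (- real i) / (2 :: real)"
        using powr_add[of 2 "- real i" "-1"] by (simp add: powr_minus field_simps)
      have "par (Suc i) a \<in> cov i" using par_in_cov[of "Suc i" a] Suc.prems by simp
      then have "\<bar>l (par (Suc i) a) - l (anc par j (Suc i) a)\<bar>
          \<le> 2 * c * (2 powr (- real j) - 2 powr (- real i))"
        using Suc.IH[OF j] Suc.prems j by simp
      moreover have "\<bar>l a - l (par (Suc i) a)\<bar> \<le> c * 2 powr (- real i)"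
        using par_dist[OF l] Suc.prems by simp
      ultimately show ?thesis unfolding half by (simp add: algebra_simps)
    qed simp
  qed simp
  have range: "\<bar>l a - l b\<bar> \<le> level_scale c j"
    if l: "l \<in> Loss" and a: "a \<in> cov L" and b: "b \<in> cov L" and j: "j \<in> {1..L}"
      and eq: "anc_leaf (j - 1) a = anc_leaf (j - 1) b" for l a b j
  proof -
    have "\<bar>l x - l (anc_leaf (j - 1) x)\<bar> \<le> 2 * c * 2 powr (- real (j - 1))" if "x \<in> cov L" for x
    proof -
      have "\<bar>l x - l (anc_leaf (j - 1) x)\<bar> \<le> 2 * c * (2 powr (- real (j - 1)) - 2 powr (- real L))"
        using j that by (intro anc_dist[OF l]) auto
      also have "\<dots> \<le> 2 * c * 2 powr (- real (j - 1))" using \<open>c > 0\<close> by (intro mult_left_mono) auto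
      finally show ?thesis .
    qed
    \<comment> \<open>Two paths to the common ancestor, each of length at most twice the radius
      \<open>c * 2 powr (- real (j - 1))\<close>. Going from j - 1 to j doubles the 4 to 8, the
      constant in \<open>level_scale\<close>.\<close>
    from this[OF a] this[OF b] have "\<bar>l a - l b\<bar> \<le> 4 * c * 2 powr (- real (j - 1))"
      unfolding eq by linarith
    also have "\<dots> = level_scale c j"
      unfolding level_scale_eq using j powr_add[of 2 "- real j" 1] by (simp add: of_nat_diff)
    finally show ?thesis .
  qed
  interpret two_point_ftrl_game M F A Loss y act1 lev act2 cov par L a0 "level_scale c" "level_dist cov L" p
    using assms(3,9) sub[OF order_refl] range by unfold_locales auto
  let ?G = "\<integral>\<omega>. (\<Sum>t=1..T. (y t \<omega> (act1 t \<omega>) + y t \<omega> (act2 t \<omega>)) / 2) \<partial>M"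
  let ?B = "16 * (9 + 4 * sqrt 6) * sqrt (K_eff c cov L * real T)"
  have \<delta>T: "1 / real T \<le> level_dist cov L j" if "j \<in> {1..L}" for j
    using assms(11) that by (meson Min_le finite_atLeastAtMost finite_imageI image_eqI order_trans)
  have K: "sqrt (K_eff c cov L * real T) = c * ?S * sqrt ?S * sqrt (real T)"
  proof -
    have "K_eff c cov L * real T = (c * ?S)\<^sup>2 * (?S * real T)"
      unfolding K_eff_def level_weight_def by (simp add: power2_eq_square power3_eq_cube mult_ac)
    moreover have "sqrt ((c * ?S)\<^sup>2) = c * ?S"
      using \<open>c > 0\<close> S by (simp only: real_sqrt_abs abs_of_pos mult_pos_pos)
    ultimately show ?thesis by (simp only: real_sqrt_mult mult.assoc)
  qed
  have "(\<Sum>j=1..L. level_scale c j * sqrt (card (cov j)) / sqrt (level_dist cov L j))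
     = (\<Sum>j=1..L. 8 * c * sqrt ?S * level_weight cov j)"
    unfolding level_dist_def using level_scale_sqrt_card[OF fin nonempty S]
    by (intro sum.cong refl) auto
  also have "\<dots> = 8 * c * sqrt ?S * ?S" by (rule sum_distrib_left[symmetric])
  finally have "16 * sqrt (real T) * (\<Sum>j=1..L. level_scale c j * sqrt (card (cov j)) / sqrt (level_dist cov L j))
     = 128 * sqrt (K_eff c cov L * real T)"
    unfolding K by simp
  \<comment> \<open>The argument yields 16 * 8 = 128, and 8 is below
    \<open>9 + 4 * sqrt 6\<close>.\<close>
  also have "\<dots> \<le> ?B"
    unfolding K using \<open>c > 0\<close> S by (intro mult_right_mono) auto
  finally have leaf: "?G - (\<integral>\<omega>. (\<Sum>t=1..T. y t \<omega> b) \<partial>M) \<le> ?B" if "b \<in> cov L" for b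
    using leaf_regret_bound[OF \<open>T \<ge> 1\<close> that] regret_terms_le[OF \<open>T \<ge> 1\<close> \<delta>T] by linarith
  \<comment> \<open>An infimum over a nonempty set is bounded below by a common lower bound. Each
    action is compared with a leaf within the last radius of it.\<close>
  have "?G - ?B - c * 2 powr (- real L) * real T \<le> (INF a\<in>A. \<integral>\<omega>. (\<Sum>t=1..T. y t \<omega> a) \<partial>M)"
  proof (rule cINF_greatest)
    fix a assume a: "a \<in> A"
    obtain b where b: "b \<in> cov L" "loss_dist Loss a b \<le> ennreal (c * 2 powr (- real L))"
      using cover[of L] a unfolding is_cover_def by auto
    have b': "b \<in> A" using sub[of L] b by auto
    have near: "y t \<omega> b \<le> y t \<omega> a + c * 2 powr (- real L)" if "1 \<le> t" "\<omega> \<in> space M" for t \<omega>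
      using loss_dist_le[OF loss_in[OF that] b(2)] \<open>c > 0\<close> by simp
    have "(\<integral>\<omega>. (\<Sum>t=1..T. y t \<omega> b) \<partial>M)
        \<le> (\<integral>\<omega>. (\<Sum>t=1..T. y t \<omega> a) + c * 2 powr (- real L) * real T \<partial>M)"
    proof (rule integral_mono)
      fix \<omega> assume "\<omega> \<in> space M"
      then have "(\<Sum>t=1..T. y t \<omega> b) \<le> (\<Sum>t=1..T. y t \<omega> a + c * 2 powr (- real L))"
        using near by (intro sum_mono) auto
      then show "(\<Sum>t=1..T. y t \<omega> b) \<le> (\<Sum>t=1..T. y t \<omega> a) + c * 2 powr (- real L) * real T"
        by (simp add: sum.distrib mult.commute)
    qed (use a b' loss_integrable in \<open>auto intro!: Bochner_Integration.integrable_sum Bochner_Integration.integrable_add\<close>)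
    also have "\<dots> = (\<integral>\<omega>. (\<Sum>t=1..T. y t \<omega> a) \<partial>M) + c * 2 powr (- real L) * real T"
      using a loss_integrable
      by (subst Bochner_Integration.integral_add) (auto simp: prob_space)
    finally show "?G - ?B - c * 2 powr (- real L) * real T \<le> (\<integral>\<omega>. (\<Sum>t=1..T. y t \<omega> a) \<partial>M)"
      using leaf[OF b(1)] by linarith
  qed (use \<open>a0 \<in> A\<close> in auto)
  then show ?thesis unfolding regret2_def by linarith
qed

end
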